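(* Let $\mathcal B$ be the set of bad edges in the Cayley complex $X$ with respect to the nested traversal 0-combing. Suppose that (1) there is a partial ordering of $\mathcal B$ such that for every $e\in\mathcal B$ the set $\{f\in\mathcal B: f<e\}$ is finite, and (2) there is a function $c$ from $\mathcal B$ to the set of 2-cells of $X$ such that for every $e\in\mathcal B$ the edge $e$ lies on the boundary of $c(e)$, and whenever $f\in\mathcal B$ is another edge on the boundary of $c(e)$, then $f<e$. Then the nested traversal 0-combing $\Psi:X^0\times[0,1]\to X^1$ can be extended to a 1-combing $\Psi:X^1\times[0,1]\to X$.
   Context: $F$ is Thompson's group with presentation $\langle x_0,x_1\mid [x_0x_1^{-1},x_0^{-1}x_1x_0],[x_0x_1^{-1},x_0^{-2}x_1x_0^2]\rangle$, and $X$ is the Cayley 2-complex of this presentation, $X^0=F$, $X^1$ the Cayley graph, $\epsilon$ the identity. A 0-combing is a continuous $\Psi:X^0\times[0,1]\to X^1$ with $\Psi(x,0)=\epsilon$, $\Psi(x,1)=x$; a 1-combing is a continuous $\Psi:X^1\times[0,1]\to X$ with $\Psi(x,0)=\epsilon$, $\Psi(x,1)=x$ and $\Psi(X^0\times[0,1])\subseteq X^1$. The nested traversal 0-combing sends $w\in F$ to the path $\Psi_w$ in $X^1$ from $\epsilon$ to $w$ labelled by the nested traversal normal form $\eta(w)$, defined as follows. Elements of $F$ are represented by reduced tree pair diagrams $(T_-(w),T_+(w))$ of rooted binary trees with $N(w)$ carets each (carets numbered in infix order from 1); a caret is a right (left) caret if one of its edges lies on the right (left) side of the tree, the root being both, other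 carets interior. Nested traversal word $\gamma(T)$ of a tree $T$: go through carets in infix order, skipping carets in the right subtree of a caret to which rule (3) or (5) has been applied, appending: (1) nothing for caret number 1; (2) $x_0^{-1}$ for a left caret with number $>1$; (3) $x_0^{-1}\gamma(T')x_0x_1^{-1}$ for an interior caret with nonempty right subtree $T'$ (regarded as a tree on its own); (4) $x_1^{-1}$ for an interior caret with empty right subtree; (5) $x_0^{-1}\gamma(T')x_0$ for a non-root right caret whose right subtree $T'$ contains an interior caret; (6) nothing for a non-root right caret whose right subtree has no interior caret. Then $\eta(w)$ is the free reduction of $\gamma(T_+(w))^{-1}\gamma(T_-(w))$. For $a\in\{0,1\}$ and $w\in F$, $e_a(w)$ denotes the edge with endpoints $w$ and $wx_a^{-1}$. The edge $e_a(w)$ is good if the loop $\Psi_w\, e_a(w)\,\Psi_{wx_a^{-1}}^{-1}$ is homotopic to the trivial loop in the Cayley graph $X^1$, and bad otherwise.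
   Formalization: In the nested traversal word, carets of T' in rules (3) and (5) keep their left/right/interior type from the whole tree rather than being retyped in T' as a tree on its own; otherwise η(w) need not represent w and the 0-combing is undefined. *)

theory Defs
  imports "HOL-Analysis.Analysis"
begin

text \<open>Elements of F are realised as piecewise-linear maps real => real (identity outside [0,1]).
  The group product is composition: the word a1 a2 ... an evaluates to a1 o a2 o ... o an.
  With this convention the two relators of the presentation hold, and a reduced tree pair
  diagram (T-, T+) of w means: w maps the i-th leaf interval of T- affinely onto the i-th
  leaf interval of T+.\<close>

datatype gen = X0 | X1

type_synonym letter = "gen \<times> bool"   \<comment> \<open>(a, True) = x_a, (a, False) = x_a^-1\<close>
type_synonym elt = "real \<Rightarrow> real"

definition x0f :: "real \<Rightarrow> real" where
  "x0f t = (if t < 0 \<or> t > 1 then t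
            else if t \<le> 1/2 then t / 2
            else if t \<le> 3/4 then t - 1/4
            else 2 * t - 1)"

definition x1f :: "real \<Rightarrow> real" where
  "x1f t = (if t < 1/2 \<or> t > 1 then t
            else if t \<le> 3/4 then t / 2 + 1/4
            else if t \<le> 7/8 then t - 1/8
            else 2 * t - 1)"

fun genf :: "gen \<Rightarrow> elt" where
  "genf X0 = x0f"
| "genf X1 = x1f"

fun letf :: "letter \<Rightarrow> elt" where
  "letf (a, True) = genf a"
| "letf (a, False) = inv (genf a)"

definition evalword :: "letter list \<Rightarrow> elt" where
  "evalword ws = foldr (\<lambda>l f. letf l \<circ> f) ws id"

definition Fgrp :: "elt set" where
  "Fgrp = range evalword"

definition eps :: elt where "eps = id"

fun letter_inv :: "letter \<Rightarrow> letter" where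
  "letter_inv (a, b) = (a, \<not> b)"

definition word_inv :: "letter list \<Rightarrow> letter list" where
  "word_inv ws = rev (map letter_inv ws)"

definition freered :: "letter list \<Rightarrow> letter list" where
  "freered ws = foldr (\<lambda>l acc. case acc of [] \<Rightarrow> [l]
                          | m # rest \<Rightarrow> (if m = letter_inv l then rest else l # acc)) ws []"

datatype tree = Leaf | Node tree tree

fun leaves :: "tree \<Rightarrow> real \<Rightarrow> real \<Rightarrow> (real \<times> real) list" where
  "leaves Leaf a b = [(a, b)]"
| "leaves (Node L R) a b = leaves L a ((a + b) / 2) @ leaves R ((a + b) / 2) b"

fun nleaves :: "tree \<Rightarrow> nat" where
  "nleaves Leaf = 1"
| "nleaves (Node L R) = nleaves L + nleaves R"

fun exposed :: "tree \<Rightarrow> nat \<Rightarrow> nat set" where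
  "exposed Leaf n = {}"
| "exposed (Node Leaf Leaf) n = {n}"
| "exposed (Node L R) n = exposed L n \<union> exposed R (n + nleaves L)"

definition represents :: "elt \<Rightarrow> tree \<Rightarrow> tree \<Rightarrow> bool" where
  "represents f T1 T2 \<longleftrightarrow>
     (let A = leaves T1 0 1; B = leaves T2 0 1 in
      length A = length B \<and>
      (\<forall>i < length A. \<forall>t. fst (A!i) \<le> t \<and> t \<le> snd (A!i) \<longrightarrow>
          f t = fst (B!i) + (t - fst (A!i)) * (snd (B!i) - fst (B!i)) / (snd (A!i) - fst (A!i))))"

definition reduced_pair :: "tree \<Rightarrow> tree \<Rightarrow> bool" where
  "reduced_pair T1 T2 \<longleftrightarrow> exposed T1 0 \<inter> exposed T2 0 = {}"

definition tree_pair :: "elt \<Rightarrow> tree \<times> tree" where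
  "tree_pair w = (THE p. reduced_pair (fst p) (snd p) \<and> represents w (fst p) (snd p))"

definition Tminus :: "elt \<Rightarrow> tree" where "Tminus w = fst (tree_pair w)"
definition Tplus :: "elt \<Rightarrow> tree" where "Tplus w = snd (tree_pair w)"

datatype ckind = KRoot | KLeft | KRight | KInt

fun lkind :: "ckind \<Rightarrow> ckind" where
  "lkind KRoot = KLeft" | "lkind KLeft = KLeft" | "lkind KRight = KInt" | "lkind KInt = KInt"

fun rkind :: "ckind \<Rightarrow> ckind" where
  "rkind KRoot = KRight" | "rkind KLeft = KInt" | "rkind KRight = KRight" | "rkind KInt = KInt"

text \<open>A subtree hanging off the right side contains no interior caret iff it is a right vine.\<close>
fun right_vine :: "tree \<Rightarrow> bool" where
  "right_vine Leaf = True"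
| "right_vine (Node L R) = (L = Leaf \<and> right_vine R)"

text \<open>Infix traversal; the caret numbered 1 is the unique KRoot/KLeft caret with empty left
  subtree (rule 1). Rules (3) and (5) emit the nested word and skip the right subtree.\<close>
fun walk :: "ckind \<Rightarrow> tree \<Rightarrow> letter list" where
  "walk k Leaf = []"
| "walk k (Node L R) = walk (lkind k) L @
     (case k of
        KRoot \<Rightarrow> (if L = Leaf then [] else [(X0, False)]) @ walk (rkind k) R
      | KLeft \<Rightarrow> (if L = Leaf then [] else [(X0, False)]) @ walk (rkind k) R
      | KInt \<Rightarrow> (if R = Leaf then [(X1, False)]
                 else [(X0, False)] @ walk KInt R @ [(X0, True), (X1, False)])
      | KRight \<Rightarrow> (if right_vine R then walk KRight R
                   else [(X0, False)] @ walk KRight R @ [(X0, True)]))"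

definition gamma :: "tree \<Rightarrow> letter list" where
  "gamma T = walk KRoot T"

definition eta :: "elt \<Rightarrow> letter list" where
  "eta w = freered (word_inv (gamma (Tplus w)) @ gamma (Tminus w))"

definition relA :: "letter list" where "relA = [(X0, True), (X1, False)]"
definition relB1 :: "letter list" where "relB1 = [(X0, False), (X1, True), (X0, True)]"
definition relB2 :: "letter list" where
  "relB2 = [(X0, False), (X0, False), (X1, True), (X0, True), (X0, True)]"

definition commw :: "letter list \<Rightarrow> letter list \<Rightarrow> letter list" where
  "commw u v = u @ v @ word_inv u @ word_inv v"

fun rel :: "nat \<Rightarrow> letter list" where
  "rel 0 = commw relA relB1"
| "rel _ = commw relA relB2"

text \<open>Points of X: vertices, interior points of edges (edge from w to w x_a, parameter in (0,1)),
  interior points of 2-cells (cell (g,i) attached along the loop from g labelled rel i,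
  polar-like coordinates s in [0,1), radius in (0,1)), and centres of 2-cells.\<close>
datatype xpt = Vert elt | EPt elt gen real | CPt elt nat real real | CCen elt nat

definition edgept :: "elt \<Rightarrow> gen \<Rightarrow> real \<Rightarrow> xpt" where
  "edgept w a t = (if t \<le> 0 then Vert w else if t \<ge> 1 then Vert (w \<circ> genf a) else EPt w a t)"

definition wpath :: "elt \<Rightarrow> letter list \<Rightarrow> real \<Rightarrow> xpt" where
  "wpath g ws s =
     (if ws = [] then Vert g
      else let n = length ws; k = min (nat \<lfloor>s * real n\<rfloor>) (n - 1); \<tau> = s * real n - real k;
               h = g \<circ> evalword (take k ws) in
           (case ws ! k of
              (a, True) \<Rightarrow> edgept h a \<tau>
            | (a, False) \<Rightarrow> edgept (h \<circ> inv (genf a)) a (1 - \<tau>)))"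

text \<open>Characteristic map of the 2-cell (g,i), defined on the square [0,1]x[0,1]
  (quotient of the square onto the closed disc: (s,1) on the boundary, (s,0) the centre).\<close>
definition charC :: "elt \<Rightarrow> nat \<Rightarrow> real \<times> real \<Rightarrow> xpt" where
  "charC g i p = (let s = fst p; \<rho> = snd p in
     if \<rho> \<ge> 1 then wpath g (rel i) s
     else if \<rho> \<le> 0 then CCen g i
     else if s \<le> 0 \<or> s \<ge> 1 then CPt g i 0 \<rho> else CPt g i s \<rho>)"

definition X1car :: "xpt set" where
  "X1car = (\<Union>w\<in>Fgrp. \<Union>a. edgept w a ` {0..1})"

definition Xcar :: "xpt set" where
  "Xcar = X1car \<union> (\<Union>g\<in>Fgrp. \<Union>i\<in>{0,1}. charC g i ` ({0..1} \<times> {0..1}))"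

definition Xtop :: "xpt topology" where
  "Xtop = topology (\<lambda>U. U \<subseteq> Xcar \<and>
      (\<forall>w\<in>Fgrp. \<forall>a. openin (top_of_set {0..1}) {t\<in>{0..1}. edgept w a t \<in> U}) \<and>
      (\<forall>g\<in>Fgrp. \<forall>i\<in>{0,1}. openin (top_of_set ({0..1} \<times> {0..1}))
                                  {p\<in>{0..1} \<times> {0..1}. charC g i p \<in> U}))"


lemma istopology_Xtop:
  "istopology (\<lambda>U. U \<subseteq> Xcar \<and>
      (\<forall>w\<in>Fgrp. \<forall>a. openin (top_of_set {0..1}) {t\<in>{0..1}. edgept w a t \<in> U}) \<and>
      (\<forall>g\<in>Fgrp. \<forall>i\<in>{0,1}. openin (top_of_set ({0..1} \<times> {0..1}))
                                  {p\<in>{0..1} \<times> {0..1}. charC g i p \<in> U}))"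
proof -
  have i1: "{t\<in>S. f t \<in> U \<inter> V} = {t\<in>S. f t \<in> U} \<inter> {t\<in>S. f t \<in> V}" for S :: "'b set" and f :: "'b \<Rightarrow> xpt" and U V
    by auto
  have u1: "{t\<in>S. f t \<in> \<Union>K} = \<Union>((\<lambda>U. {t\<in>S. f t \<in> U}) ` K)" for S :: "'b set" and f :: "'b \<Rightarrow> xpt" and K
    by auto
  show ?thesis
    unfolding istopology_def
  proof (rule conjI; intro allI impI)
    fix S T assume S: "S \<subseteq> Xcar \<and> (\<forall>w\<in>Fgrp. \<forall>a. openin (top_of_set {0..1}) {t\<in>{0..1}. edgept w a t \<in> S}) \<and>
      (\<forall>g\<in>Fgrp. \<forall>i\<in>{0,1}. openin (top_of_set ({0..1} \<times> {0..1})) {p\<in>{0..1} \<times> {0..1}. charC g i p \<in> S})"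
      and T: "T \<subseteq> Xcar \<and> (\<forall>w\<in>Fgrp. \<forall>a. openin (top_of_set {0..1}) {t\<in>{0..1}. edgept w a t \<in> T}) \<and>
      (\<forall>g\<in>Fgrp. \<forall>i\<in>{0,1}. openin (top_of_set ({0..1} \<times> {0..1})) {p\<in>{0..1} \<times> {0..1}. charC g i p \<in> T})"
    show "S \<inter> T \<subseteq> Xcar \<and> (\<forall>w\<in>Fgrp. \<forall>a. openin (top_of_set {0..1}) {t\<in>{0..1}. edgept w a t \<in> S \<inter> T}) \<and>
      (\<forall>g\<in>Fgrp. \<forall>i\<in>{0,1}. openin (top_of_set ({0..1} \<times> {0..1})) {p\<in>{0..1} \<times> {0..1}. charC g i p \<in> S \<inter> T})"
      using S T by (simp only: i1) (intro conjI ballI allI openin_Int; blast)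
  next
    fix K assume K: "\<forall>U\<in>K. U \<subseteq> Xcar \<and> (\<forall>w\<in>Fgrp. \<forall>a. openin (top_of_set {0..1}) {t\<in>{0..1}. edgept w a t \<in> U}) \<and>
      (\<forall>g\<in>Fgrp. \<forall>i\<in>{0,1}. openin (top_of_set ({0..1} \<times> {0..1})) {p\<in>{0..1} \<times> {0..1}. charC g i p \<in> U})"
    show "\<Union>K \<subseteq> Xcar \<and> (\<forall>w\<in>Fgrp. \<forall>a. openin (top_of_set {0..1}) {t\<in>{0..1}. edgept w a t \<in> \<Union>K}) \<and>
      (\<forall>g\<in>Fgrp. \<forall>i\<in>{0,1}. openin (top_of_set ({0..1} \<times> {0..1})) {p\<in>{0..1} \<times> {0..1}. charC g i p \<in> \<Union>K})"
      using K by (simp only: u1) (intro conjI ballI allI openin_Union; blast)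
  qed
qed

definition X1top :: "xpt topology" where
  "X1top = subtopology Xtop X1car"

definition Psi0 :: "elt \<Rightarrow> real \<Rightarrow> xpt" where
  "Psi0 w t = wpath eps (eta w) t"

definition pjoin :: "(real \<Rightarrow> 'a) \<Rightarrow> (real \<Rightarrow> 'a) \<Rightarrow> real \<Rightarrow> 'a" where
  "pjoin g1 g2 = (\<lambda>x. if x \<le> 1/2 then g1 (2 * x) else g2 (2 * x - 1))"

definition prev :: "(real \<Rightarrow> 'a) \<Rightarrow> real \<Rightarrow> 'a" where
  "prev g = (\<lambda>x. g (1 - x))"

text \<open>The edge e_a(w), joining w and w x_a^-1, traversed from w to w x_a^-1.\<close>
definition epath :: "elt \<Rightarrow> gen \<Rightarrow> real \<Rightarrow> xpt" where
  "epath w a = (\<lambda>t. edgept (w \<circ> inv (genf a)) a (1 - t))"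

definition good_edge :: "elt \<Rightarrow> gen \<Rightarrow> bool" where
  "good_edge w a \<longleftrightarrow>
     homotopic_with (\<lambda>r. r 1 = r 0) (top_of_set {0..1}) X1top
       (pjoin (Psi0 w) (pjoin (epath w a) (prev (Psi0 (w \<circ> inv (genf a))))))
       (\<lambda>_. Vert eps)"

text \<open>Bad edges, an edge e_a(w) being recorded as the pair (w, a).\<close>
definition BadEdges :: "(elt \<times> gen) set" where
  "BadEdges = {(w, a). w \<in> Fgrp \<and> \<not> good_edge w a}"

text \<open>Edges on the boundary of the 2-cell (g,i), in the e_a(w) notation.\<close>
definition cell_edges :: "elt \<times> nat \<Rightarrow> (elt \<times> gen) set" where
  "cell_edges c = (let g = fst c; r = rel (snd c) in
     {e. \<exists>k < length r. let h = g \<circ> evalword (take k r) in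
          (case r ! k of (a, True) \<Rightarrow> e = (h \<circ> genf a, a) | (a, False) \<Rightarrow> e = (h, a))})"

definition Cells :: "(elt \<times> nat) set" where
  "Cells = Fgrp \<times> {0, 1}"

definition is_1_combing :: "(xpt \<times> real \<Rightarrow> xpt) \<Rightarrow> bool" where
  "is_1_combing \<Psi> \<longleftrightarrow>
     continuous_map (prod_topology X1top (top_of_set {0..1})) Xtop \<Psi> \<and>
     (\<forall>x\<in>X1car. \<Psi> (x, 0) = Vert eps \<and> \<Psi> (x, 1) = x) \<and>
     (\<forall>w\<in>Fgrp. \<forall>t\<in>{0..1}. \<Psi> (Vert w, t) \<in> X1car)"

end

theory Submission
  imports Defs
begin

text \<open>Call an edge combed if it, together with the two combing paths of its endpoints, bounds a square
  in \<open>X\<close>. If all edges are combed, the squares glue to a 1-combing, since a map on \<open>X\<^sup>1 \<times> [0,1]\<close> is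
  continuous as soon as it is so over each edge. Good edges are combed, as a freely null-homotopic
  loop is null-homotopic relative to its base point. In the groupoid of homotopy classes of paths, the
  boundary of a 2-cell is trivial, so if all but one of its edges are combed, then so is the last one;
  well-founded induction along the ordering therefore combs every bad edge, using the cell \<open>c e\<close>.

  That the path \<^term>\<open>Psi0 w\<close> ends at \<open>w\<close> needs no knowledge of tree pair diagrams: if it failed,
  all edges at \<open>w\<close> would be bad, because the loops defining goodness would be discontinuous. But a
  minimal bad edge at \<open>w\<close> cannot exist, as its cell has a second edge at \<open>w\<close>.\<close>

subsection \<open>Words and boundary edges\<close>

lemma inv_x0f: "inv x0f = (\<lambda>t. if t < 0 \<or> t > 1 then t else if t \<le> 1/4 then 2 * t
    else if t \<le> 1/2 then t + 1/4 else (t + 1) / 2)" (is "_ = ?g")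
  and bij_x0f: "bij x0f"
proof -
  have *: "x0f \<circ> ?g = id" "?g \<circ> x0f = id"
    by (auto simp: x0f_def fun_eq_iff field_simps)
  show "inv x0f = ?g" "bij x0f"
    using * by (auto intro: inv_unique_comp o_bij)
qed

lemma inv_x1f: "inv x1f = (\<lambda>t. if t < 1/2 \<or> t > 1 then t else if t \<le> 5/8 then 2 * t - 1/2
    else if t \<le> 3/4 then t + 1/8 else (t + 1) / 2)" (is "_ = ?g")
  and bij_x1f: "bij x1f"
proof -
  have *: "x1f \<circ> ?g = id" "?g \<circ> x1f = id"
    by (auto simp: x1f_def fun_eq_iff field_simps)
  show "inv x1f = ?g" "bij x1f"
    using * by (auto intro: inv_unique_comp o_bij)
qed

lemma bij_genf: "bij (genf a)"
  by (cases a) (auto simp: bij_x0f bij_x1f)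

lemma genf_comp_inv [simp]:
  "genf a \<circ> inv (genf a) = id" "inv (genf a) \<circ> genf a = id"
  "(h \<circ> genf a) \<circ> inv (genf a) = h" "(h \<circ> inv (genf a)) \<circ> genf a = h"
  using bij_genf[of a] by (auto simp: bij_def surj_iff fun_eq_iff surj_f_inv_f)

lemma bij_letf: "bij (letf l)"
  by (cases l rule: letf.cases) (auto simp: bij_genf bij_imp_bij_inv)

lemma evalword_Nil [simp]: "evalword [] = id"
  and evalword_Cons [simp]: "evalword (l # ws) = letf l \<circ> evalword ws"
  by (auto simp: evalword_def)

lemma evalword_append [simp]: "evalword (u @ v) = evalword u \<circ> evalword v"
  by (induction u) auto

lemma bij_evalword: "bij (evalword ws)"
proof (induction ws)
  case (Cons l ws)
  then show ?case
    by (metis bij_comp bij_letf evalword_Cons)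
qed (metis bij_id evalword_Nil)

lemma Fgrp_bij: "g \<in> Fgrp \<Longrightarrow> bij g"
  by (auto simp: Fgrp_def bij_evalword)

lemma eps_in_Fgrp [simp]: "eps \<in> Fgrp"
  unfolding Fgrp_def eps_def by (metis evalword_Nil rangeI)

lemma Fgrp_evalword [intro, simp]: "g \<in> Fgrp \<Longrightarrow> g \<circ> evalword ws \<in> Fgrp"
  by (auto simp: Fgrp_def simp flip: evalword_append)

lemma Fgrp_letf [intro, simp]: "g \<in> Fgrp \<Longrightarrow> g \<circ> letf l \<in> Fgrp"
  using Fgrp_evalword[of g "[l]"] by simp

lemma Fgrp_genf [intro, simp]:
  "g \<in> Fgrp \<Longrightarrow> g \<circ> genf a \<in> Fgrp" "g \<in> Fgrp \<Longrightarrow> g \<circ> inv (genf a) \<in> Fgrp"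
  using Fgrp_letf[of g "(a, True)"] Fgrp_letf[of g "(a, False)"] by auto

text \<open>The relators hold because the two elements of each commutator have disjoint supports, in
  [0,3/4] and in [3/4,1].\<close>

lemma genf_bounds:
  "t \<le> 3/4 \<Longrightarrow> x0f t \<le> 1/2" "3/4 \<le> t \<Longrightarrow> 1/2 \<le> x0f t" "1/2 \<le> t \<Longrightarrow> 3/4 \<le> inv x0f t"
  "t \<le> 1/2 \<Longrightarrow> x1f t = t" "1/2 \<le> t \<Longrightarrow> 1/2 \<le> x1f t"
  "3/4 \<le> t \<Longrightarrow> x0f (inv x1f t) = t" "t \<le> 3/4 \<Longrightarrow> x0f (inv x1f t) \<le> 3/4"
  by (auto simp: x0f_def x1f_def inv_x0f inv_x1f field_simps)

lemma evalword_relA: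
  "3/4 \<le> t \<Longrightarrow> evalword relA t = t" "t \<le> 3/4 \<Longrightarrow> evalword relA t \<le> 3/4"
  using genf_bounds(6,7)[of t] by (simp_all add: relA_def)

lemma evalword_relB1:
  "t \<le> 3/4 \<Longrightarrow> evalword relB1 t = t" "3/4 \<le> t \<Longrightarrow> 3/4 \<le> evalword relB1 t"
  using genf_bounds(4)[OF genf_bounds(1)] genf_bounds(3)[OF genf_bounds(5)[OF genf_bounds(2)]]
  by (simp_all add: relB1_def bij_x0f bij_is_inj)

lemma evalword_relB2:
  "t \<le> 3/4 \<Longrightarrow> evalword relB2 t = t" "3/4 \<le> t \<Longrightarrow> 3/4 \<le> evalword relB2 t"
proof -
  \<comment> \<open>\<open>relB2\<close> is the conjugate of \<open>relB1\<close> by x_0, so its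
    bounds follow from those of \<open>relB1\<close>.\<close>
  have *: "evalword relB2 t = inv x0f (evalword relB1 (x0f t))" for t
    by (simp add: relB1_def relB2_def)
  show "evalword relB2 t = t" if "t \<le> 3/4"
    using genf_bounds(1)[OF that] by (simp add: * evalword_relB1 bij_x0f bij_is_inj)
  show "3/4 \<le> evalword relB2 t" if "3/4 \<le> t"
  proof -
    \<comment> \<open>\<open>relB1\<close> maps the half-line from 1/2 into itself: it fixes the
      part up to 3/4 and preserves the rest. Then \<open>inv x0f\<close> moves the result beyond
      3/4.\<close>
    have "1/2 \<le> evalword relB1 (x0f t)"
      using genf_bounds(2)[OF that] evalword_relB1[of "x0f t"] by linarith
    then show ?thesis
      unfolding * by (rule genf_bounds)
  qed
qed

lemma letf_letter_inv: "letf (letter_inv l) = inv (letf l)"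
  by (cases l rule: letf.cases) (auto simp: bij_genf inv_inv_eq)

lemma evalword_word_inv: "evalword (word_inv ws) = inv (evalword ws)"
proof (induction ws)
  case (Cons l ws)
  have "evalword (word_inv (l # ws)) = inv (evalword ws) \<circ> inv (letf l)"
    using Cons by (simp add: word_inv_def letf_letter_inv)
  then show ?case
    by (simp only: evalword_Cons o_inv_distrib[OF bij_letf bij_evalword])
qed (simp add: word_inv_def)

text \<open>Each of \<open>u\<close> and \<open>v\<close> moves points on one side of
  \<open>c\<close> only and preserves that side, so the two maps commute.\<close>

lemma evalword_commw:
  assumes "\<And>t. t \<le> c \<Longrightarrow> evalword v t = t" "\<And>t. c \<le> t \<Longrightarrow> c \<le> evalword v t"
    and "\<And>t. c \<le> t \<Longrightarrow> evalword u t = t" "\<And>t. t \<le> c \<Longrightarrow> evalword u t \<le> c"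
  shows "evalword (commw u v) = id"
proof -
  have "evalword u \<circ> evalword v = evalword v \<circ> evalword u"
  proof
    fix t show "(evalword u \<circ> evalword v) t = (evalword v \<circ> evalword u) t"
      using assms by (cases "t \<le> c") auto
  qed
  moreover have "f \<circ> inv f = id" if "bij f" for f :: elt
    using that by (simp add: bij_def surj_iff)
  ultimately show ?thesis
    using bij_evalword[of u] bij_evalword[of v]
    by (simp add: commw_def evalword_word_inv fun_eq_iff) (metis bij_inv_eq_iff)
qed

lemma evalword_rel: "evalword (rel i) = id"
  using evalword_commw[of "3/4", OF evalword_relB1 evalword_relA]
    evalword_commw[of "3/4", OF evalword_relB2 evalword_relA]
  by (cases i) simp_all

text \<open>The edge e_a(w) is named after the head of the x_a-arrow. A letter x_a therefore
  contributes the vertex reached after reading it, a letter x_a^-1 the vertex before it.\<close>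

definition bdedge :: "elt \<Rightarrow> letter list \<Rightarrow> nat \<Rightarrow> elt \<times> gen" where
  "bdedge g ws k = (if snd (ws ! k) then g \<circ> evalword (take (Suc k) ws)
                    else g \<circ> evalword (take k ws), fst (ws ! k))"

lemma cell_edges_eq: "cell_edges (g, i) = bdedge g (rel i) ` {..<length (rel i)}"
proof -
  have *: "(let h = g \<circ> evalword (take k ws) in
          (case ws ! k of (a, True) \<Rightarrow> e = (h \<circ> genf a, a) | (a, False) \<Rightarrow> e = (h, a))) \<longleftrightarrow>
        e = bdedge g ws k" if "k < length ws" for k e and ws :: "letter list"
  proof (cases "ws ! k")
    case (Pair a b)
    then show ?thesis
      using that by (cases b) (simp_all add: bdedge_def take_Suc_conv_app_nth comp_assoc)
  qed
  then show ?thesis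
    unfolding cell_edges_def fst_conv snd_conv Let_def[of g] Let_def[of "rel i"] by (simp only: * cong: conj_cong) auto
qed

text \<open>The three sample points are chosen so that they separate all boundary edges of both kinds of
  2-cells.\<close>

definition trace :: "elt \<times> gen \<Rightarrow> (real \<times> real \<times> real) \<times> gen" where
  "trace e = ((fst e (3/4), fst e (1/8), fst e (31/32)), snd e)"

text \<open>Values at sample points turn inequality of elements of F into rational arithmetic,
  checked for the 10 and 14 letters of the two relators.\<close>

lemma distinct_trace_rel:
  assumes "i \<in> {0,1}"
  shows "distinct (map (\<lambda>k. trace (bdedge id (rel i) k)) [0..<length (rel i)])"
proof -
  note rels = commw_def word_inv_def relA_def relB1_def relB2_def
  note gens = fun_cong[OF inv_x0f] fun_cong[OF inv_x1f] x0f_def x1f_def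
  have upt0: "[0..<length (rel 0)] = [0,1,2,3,4,5,6,7,8,9]"
    and upt1: "[0..<length (rel 1)] = [0,1,2,3,4,5,6,7,8,9,10,11,12,13]"
    by (simp_all add: rels upt_rec)
  have "distinct (map (\<lambda>k. trace (bdedge id (rel 0) k)) [0..<length (rel 0)])"
    unfolding upt0 list.map bdedge_def trace_def by (simp add: rels) (simp add: gens)
  moreover have "distinct (map (\<lambda>k. trace (bdedge id (rel 1) k)) [0..<length (rel 1)])"
    unfolding upt1 list.map bdedge_def trace_def by (simp add: rels) (simp add: gens)
  ultimately show ?thesis using assms by auto
qed

text \<open>Left translation by \<open>g\<close> is injective, which reduces the claim to
  \<open>g = id\<close>. Each boundary edge is thus crossed exactly once, so a cell relation can be
  solved for any one of its edges.\<close>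

lemma inj_on_bdedge:
  assumes "i \<in> {0,1}" "g \<in> Fgrp"
  shows "inj_on (bdedge g (rel i)) {..<length (rel i)}"
proof
  fix k l assume kl: "k \<in> {..<length (rel i)}" "l \<in> {..<length (rel i)}"
    and eq: "bdedge g (rel i) k = bdedge g (rel i) l"
  have "inj g" using Fgrp_bij[OF assms(2)] by (simp add: bij_def)
  then have "bdedge id (rel i) k = bdedge id (rel i) l"
    using eq by (auto simp: bdedge_def fun.inj_map_strong fun_eq_iff inj_eq split: if_splits)
  then show "k = l"
    using distinct_trace_rel[OF assms(1)] kl by (auto simp: distinct_map inj_on_def)
qed

subsection \<open>The topology of X\<close>

lemma openin_Xtop:
  "openin Xtop U \<longleftrightarrow> U \<subseteq> Xcar \<and>
      (\<forall>w\<in>Fgrp. \<forall>a. openin (top_of_set {0..1}) {t\<in>{0..1}. edgept w a t \<in> U}) \<and>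
      (\<forall>g\<in>Fgrp. \<forall>i\<in>{0,1}. openin (top_of_set ({0..1} \<times> {0..1}))
                                  {p\<in>{0..1} \<times> {0..1}. charC g i p \<in> U})"
  unfolding Xtop_def by (simp only: topology_inverse' istopology_Xtop)

lemma edgept_in_X1car [intro, simp]:
  assumes "w \<in> Fgrp" "t \<in> {0..1}"
  shows "edgept w a t \<in> X1car"
proof -
  have "edgept w a t \<in> edgept w a ` {0..1}" using assms(2) by (rule imageI)
  then show ?thesis using assms(1) unfolding X1car_def by blast
qed

lemma X1car_subset_Xcar: "X1car \<subseteq> Xcar"
  by (auto simp: Xcar_def)

lemma charC_in_Xcar [intro, simp]:
  "g \<in> Fgrp \<Longrightarrow> i \<in> {0,1} \<Longrightarrow> p \<in> {0..1} \<times> {0..1} \<Longrightarrow> charC g i p \<in> Xcar"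
  unfolding Xcar_def by blast

lemma edgept_in_Xcar [intro, simp]: "w \<in> Fgrp \<Longrightarrow> t \<in> {0..1} \<Longrightarrow> edgept w a t \<in> Xcar"
  using edgept_in_X1car X1car_subset_Xcar by blast

text \<open>Making \<^typ>\<open>xpt\<close> a topological space turns \<^const>\<open>Xtop\<close> and \<^const>\<open>X1top\<close> into subspace topologies
  and gives access to the library on homotopies of paths.\<close>

instantiation xpt :: topological_space
begin

text \<open>The type also has values that are no points of X, such as \<open>Vert w\<close> with
  \<open>w\<close> outside \<open>Fgrp\<close>. Openness is tested on the trace in
  \<open>Xcar\<close>, so these values impose no condition.\<close>

definition open_xpt :: "xpt set \<Rightarrow> bool" where
  "open_xpt U \<longleftrightarrow> openin Xtop (U \<inter> Xcar)"

instance
proof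
  have top: "openin Xtop Xcar"
  proof -
    have "{t\<in>{0..1}. edgept w a t \<in> Xcar} = {0..1}" if "w \<in> Fgrp" for w a
      using that by auto
    moreover have "{p\<in>{0..1} \<times> {0..1}. charC g i p \<in> Xcar} = {0..1} \<times> {0..1}"
      if "g \<in> Fgrp" "i \<in> {0,1}" for g i
      using charC_in_Xcar[OF that] by blast
    ultimately show ?thesis
      by (simp add: openin_Xtop)
  qed
  show "open (UNIV :: xpt set)"
    by (simp add: open_xpt_def top)
  show "open (S \<inter> T)" if "open S" "open T" for S T :: "xpt set"
  proof -
    have "S \<inter> T \<inter> Xcar = (S \<inter> Xcar) \<inter> (T \<inter> Xcar)" by auto
    with that show ?thesis unfolding open_xpt_def by (metis openin_Int)
  qed
  show "open (\<Union>K)" if "\<forall>S\<in>K. open S" for K :: "xpt set set"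
  proof -
    have "\<Union>K \<inter> Xcar = (\<Union>S\<in>K. S \<inter> Xcar)" by auto
    moreover have "openin Xtop (\<Union>S\<in>K. S \<inter> Xcar)"
      by (rule openin_Union) (use that in \<open>auto simp: open_xpt_def\<close>)
    ultimately show ?thesis by (simp only: open_xpt_def)
  qed
qed

end

lemma Xtop_eq: "Xtop = top_of_set Xcar"
proof (rule topology_eq[THEN iffD2], intro allI)
  fix U show "openin Xtop U \<longleftrightarrow> openin (top_of_set Xcar) U"
    unfolding openin_subtopology open_openin[symmetric] open_xpt_def
    by (metis inf.absorb1 openin_Xtop)
qed

lemma X1top_eq: "X1top = top_of_set X1car"
  by (simp add: X1top_def Xtop_eq subtopology_subtopology inf_absorb2 X1car_subset_Xcar)

lemma continuous_on_edgept:
  assumes "w \<in> Fgrp"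
  shows "continuous_on {0..1} (edgept w a)"
  unfolding continuous_openin_preimage_eq
proof (intro allI impI)
  fix U :: "xpt set" assume "open U"
  then have "openin (top_of_set {0..1}) {t\<in>{0..1}. edgept w a t \<in> U \<inter> Xcar}"
    using assms by (simp add: open_xpt_def openin_Xtop)
  also have "{t\<in>{0..1}. edgept w a t \<in> U \<inter> Xcar} = {0..1} \<inter> edgept w a -` U"
    using assms by auto
  finally show "openin (top_of_set {0..1}) ({0..1} \<inter> edgept w a -` U)" .
qed

lemma continuous_on_charC:
  assumes "g \<in> Fgrp" "i \<in> {0,1}"
  shows "continuous_on ({0..1} \<times> {0..1}) (charC g i)"
  unfolding continuous_openin_preimage_eq
proof (intro allI impI)
  fix U :: "xpt set" assume "open U"
  then have "openin (top_of_set ({0..1} \<times> {0..1})) {p\<in>{0..1} \<times> {0..1}. charC g i p \<in> U \<inter> Xcar}"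
    using assms unfolding open_xpt_def openin_Xtop by blast
  also have "{p\<in>{0..1} \<times> {0..1}. charC g i p \<in> U \<inter> Xcar} = ({0..1} \<times> {0..1}) \<inter> charC g i -` U"
    using charC_in_Xcar[OF assms] by blast
  finally show "openin (top_of_set ({0..1} \<times> {0..1})) (({0..1} \<times> {0..1}) \<inter> charC g i -` U)" .
qed

lemma edgept_0 [simp]: "edgept w a 0 = Vert w"
  and edgept_1 [simp]: "edgept w a 1 = Vert (w \<circ> genf a)"
  by (auto simp: edgept_def)

lemma Vert_in_X1car [intro, simp]: "w \<in> Fgrp \<Longrightarrow> Vert w \<in> X1car"
  using edgept_in_X1car[of w 0] by simp

lemma X1car_cases:
  assumes "x \<in> X1car"
  obtains w a t where "w \<in> Fgrp" "t \<in> {0..1}" "x = edgept w a t"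
  using assms by (auto simp: X1car_def)

subsection \<open>Edge paths\<close>

lemma wpath_Nil [simp]: "wpath g [] s = Vert g"
  by (simp add: wpath_def)

lemma wpath_single:
  assumes "s \<in> {0..1}"
  shows "wpath g [(a, True)] s = edgept g a s"
    and "wpath g [(a, False)] s = edgept (g \<circ> inv (genf a)) a (1 - s)"
  using assms by (auto simp: wpath_def)

lemma wpath_single_ends [simp]:
  "wpath g [l] 0 = Vert g" "wpath g [l] 1 = Vert (g \<circ> letf l)"
  by (cases l rule: letf.cases; simp add: wpath_single)+

text \<open>\<open>k\<close> is the position of the letter traversed at time \<open>s\<close>. The
  minimum takes effect only at s = 1, where the floor already equals
  \<open>length ws\<close>.\<close>

lemma wpath_index:
  assumes "ws \<noteq> []" "k = min (nat \<lfloor>s * real (length ws)\<rfloor>) (length ws - 1)"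
    "s \<in> {0..1}"
  shows "wpath g ws s = wpath (g \<circ> evalword (take k ws)) [ws ! k] (s * real (length ws) - real k)"
proof -
  have x: "0 \<le> s * real (length ws)" "s * real (length ws) \<le> real (length ws)"
    using assms(3) by (auto simp: mult_left_le_one_le)
  have "s * real (length ws) - real k \<in> {0..1}"
  proof (cases "nat \<lfloor>s * real (length ws)\<rfloor> \<le> length ws - 1")
    case True
    then have "real k = of_int \<lfloor>s * real (length ws)\<rfloor>"
      using x assms(2) by simp
    then show ?thesis by simp linarith
  next
    case False
    then have "k = length ws - 1" "length ws \<le> nat \<lfloor>s * real (length ws)\<rfloor>"
      using assms(2) by auto
    moreover from this have "real (length ws) \<le> s * real (length ws)"
      using x by linarith
    ultimately show ?thesis
      using x assms(1) by (cases ws) auto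
  qed
  then show ?thesis
    using assms(1) unfolding wpath_def[of g] Let_def assms(2)[symmetric]
    by (cases "ws ! k" rule: letf.cases) (simp_all add: wpath_single)
qed

text \<open>This recursion replaces the formula with the floor, so that facts about edge paths can
  be proved by induction on the word.\<close>

lemma wpath_Cons:
  assumes s: "s \<in> {0..1}" and n: "n = length ws"
  shows "wpath g (l # ws) s = (if (real n + 1) * s \<le> 1 then wpath g [l] ((real n + 1) * s)
     else wpath (g \<circ> letf l) ws (((real n + 1) * s - 1) / real n))"
proof (cases "(real n + 1) * s" "1 :: real" rule: linorder_cases)
  case less
  then have "nat \<lfloor>s * real (length (l # ws))\<rfloor> = 0"
    using n by (auto simp: algebra_simps nat_eq_iff floor_eq_iff)
  then show ?thesis
    using less n by (subst wpath_index[OF _ refl s]) (auto simp: algebra_simps)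
next
  case equal
  show ?thesis
  proof (cases ws)
    case Nil
    then show ?thesis using equal n by simp
  next
    case (Cons m vs)
    have *: "s * real (length (l # ws)) = 1"
      using equal n by (simp add: algebra_simps)
    \<comment> \<open>At time 1/(n+1) the floor already selects the second letter with parameter 0.
      This is the same vertex as the end of the first letter.\<close>
    have "min (nat \<lfloor>s * real (length (l # ws))\<rfloor>) (length (l # ws) - 1) = 1"
      unfolding * using Cons by simp
    then show ?thesis
      using equal * by (subst wpath_index[OF _ refl s]) (simp_all add: Cons)
  qed
next
  case greater
  have "n > 0"
  proof (rule ccontr)
    assume "\<not> n > 0" with greater s show False by auto
  qed
  \<comment> \<open>The position of the current letter within \<open>ws\<close>, one less than its
    position in \<open>l # ws\<close>.\<close>
  define k where "k = min (nat \<lfloor>s * real n + s - 1\<rfloor>) (n - 1)"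
  have "s * real n + s - 1 \<ge> 0" using greater by (simp add: algebra_simps)
  then have *: "nat \<lfloor>s * real n + s\<rfloor> = Suc (nat \<lfloor>s * real n + s - 1\<rfloor>)"
    by linarith
  have "s * real (length (l # ws)) = s * real n + s"
    by (simp add: n algebra_simps)
  then have k: "min (nat \<lfloor>s * real (length (l # ws))\<rfloor>) (length (l # ws) - 1) = Suc k"
    using \<open>n > 0\<close> min_Suc_Suc[of "nat \<lfloor>s * real n + s - 1\<rfloor>" "n - 1"]
    by (simp only: * k_def) (simp flip: n)
  define t where "t = ((real n + 1) * s - 1) / real n"
  have t: "t * real n = s * real n + s - 1"
    using \<open>n > 0\<close> by (simp add: t_def) (simp add: algebra_simps)
  have "t \<in> {0..1}"
    using greater mult_left_mono[of s 1 "real n + 1"] s \<open>n > 0\<close> by (auto simp: t_def field_simps)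
  have st: "s * real (length (l # ws)) - real (Suc k) = t * real n - real k"
    unfolding t by (simp add: n algebra_simps)
  have "wpath g (l # ws) s = wpath (g \<circ> letf l \<circ> evalword (take k ws)) [ws ! k] (t * real n - real k)"
    by (subst wpath_index[OF _ refl s]) (simp_all only: k st, simp_all add: comp_assoc)
  moreover have "k = min (nat \<lfloor>t * real (length ws)\<rfloor>) (length ws - 1)"
    by (simp add: k_def t flip: n)
  then have "wpath (g \<circ> letf l \<circ> evalword (take k ws)) [ws ! k] (t * real n - real k) = wpath (g \<circ> letf l) ws t"
    using wpath_index[OF _ _ \<open>t \<in> _\<close>, of ws k "g \<circ> letf l"] \<open>n > 0\<close> n by simp
  ultimately show ?thesis
    using greater by (simp add: t_def)
qed

lemma wpath_0 [simp]: "wpath g ws 0 = Vert g"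
  by (cases ws) (simp_all add: wpath_Cons)

lemma wpath_1 [simp]: "wpath g ws 1 = Vert (g \<circ> evalword ws)"
proof (induction ws arbitrary: g)
  case (Cons l ws)
  then show ?case
    by (cases "ws = []") (simp_all add: wpath_Cons[OF _ refl] comp_assoc del: o_apply)
qed (simp add: fun_eq_iff)

lemma wpath_in_X1car: "g \<in> Fgrp \<Longrightarrow> s \<in> {0..1} \<Longrightarrow> wpath g ws s \<in> X1car"
proof (induction ws arbitrary: g s)
  case (Cons l ws)
  have "wpath g [l] s \<in> X1car" if "s \<in> {0..1}" for s
    using that Cons.prems(1) by (cases l rule: letf.cases) (auto simp: wpath_single)
  moreover have "((real (length ws) + 1) * s - 1) / real (length ws) \<in> {0..1}"
    if "1 < (real (length ws) + 1) * s"
    using that Cons.prems(2) mult_left_mono[of s 1 "real (length ws) + 1"]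
    by (auto simp: divide_simps algebra_simps)
  moreover have "wpath (g \<circ> letf l) ws t \<in> X1car" if "t \<in> {0..1}" for t
    by (rule Cons.IH[OF Fgrp_letf[OF Cons.prems(1)] that])
  ultimately show ?case
    using Cons.prems(2) by (subst wpath_Cons) auto
qed simp

text \<open>For subsets of X^1 this will turn out to be closedness in X, since X^1 carries the weak
  topology of its edges.\<close>

definition edge_closed :: "xpt set \<Rightarrow> bool" where
  "edge_closed C \<longleftrightarrow> (\<forall>w\<in>Fgrp. \<forall>a. closed {t\<in>{0..1}. edgept w a t \<in> C})"

lemma closed_affine_preimage:
  fixes f :: "real \<Rightarrow> 'a"
  assumes "closed {t\<in>{0..1}. f t \<in> C}" "\<And>s. s \<in> {a..b} \<Longrightarrow> m * s + c \<in> {0..1}"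
  shows "closed {s\<in>{a..b}. f (m * s + c) \<in> C}"
proof -
  have "closed ({a..b} \<inter> (\<lambda>s. m * s + c) -` {t\<in>{0..1}. f t \<in> C})"
    by (intro continuous_closed_preimage assms continuous_intros)
  also have "\<dots> = {s\<in>{a..b}. f (m * s + c) \<in> C}"
    using assms(2) by auto
  finally show ?thesis .
qed

text \<open>An edge path is a finite chain of affinely reparametrised edges, so the preimage is a
  finite union of closed pieces. Assuming only \<open>edge_closed\<close> lets the lemma serve for
  attaching maps when such sets are shown to be closed.\<close>

lemma closed_wpath_preimage:
  assumes "edge_closed C" "g \<in> Fgrp"
  shows "closed {s\<in>{0..1}. wpath g ws s \<in> C}"
  using assms(2)
proof (induction ws arbitrary: g)
  case (Cons l ws)
  let ?N = "real (length ws) + 1"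
  have single: "closed {s\<in>{0..1}. wpath g [l] s \<in> C}"
  proof (cases l rule: letf.cases)
    case (1 a)
    then have "{s\<in>{0..1}. wpath g [l] s \<in> C} = {s\<in>{0..1}. edgept g a s \<in> C}"
      by (auto simp: wpath_single)
    then show ?thesis
      using assms(1) Cons.prems by (simp add: edge_closed_def)
  next
    case (2 a)
    then have "{s\<in>{0..1}. wpath g [l] s \<in> C} =
        {s\<in>{0..1}. edgept (g \<circ> inv (genf a)) a (-1 * s + 1) \<in> C}"
      by (auto simp: wpath_single)
    then show ?thesis
      using closed_affine_preimage[of "edgept (g \<circ> inv (genf a)) a" C 0 1 "-1" 1]
        assms(1) Cons.prems by (simp add: edge_closed_def)
  qed
  have "closed {s\<in>{0..1/?N}. wpath g [l] (?N * s + 0) \<in> C}"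
    by (rule closed_affine_preimage[OF single]) (auto simp: field_simps)
  \<comment> \<open>For empty \<open>ws\<close> the interval is the point 1, and division by 0 gives
    the parameter 0 of a constant path.\<close>
  moreover have "closed {s\<in>{1/?N..1}. wpath (g \<circ> letf l) ws ((?N / length ws) * s + - 1 / length ws) \<in> C}"
  proof (rule closed_affine_preimage[OF Cons.IH[of "g \<circ> letf l"]])
    fix s assume "s \<in> {1/?N..1}"
    then have "1 \<le> ?N * s" "?N * s \<le> ?N"
      using mult_left_mono[of s 1 ?N] by (auto simp: field_simps)
    moreover from this(2) have "?N * s - 1 \<le> length ws" by linarith
    ultimately show "(?N / length ws) * s + - 1 / length ws \<in> {0..1}"
      by (auto simp: divide_simps)
  qed (rule Fgrp_letf[OF Cons.prems])
  moreover have "{s\<in>{0..1}. wpath g (l # ws) s \<in> C} = {s\<in>{0..1/?N}. wpath g [l] (?N * s + 0) \<in> C}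
     \<union> {s\<in>{1/?N..1}. wpath (g \<circ> letf l) ws ((?N / length ws) * s + - 1 / length ws) \<in> C}" (is "?L = ?A \<union> ?B")
  proof (intro set_eqI)
    fix s
    show "s \<in> ?L \<longleftrightarrow> s \<in> ?A \<union> ?B"
    proof (cases "s \<in> {0..1}")
      case True
      have "s \<le> 1/?N \<longleftrightarrow> ?N * s \<le> 1" "1/?N \<le> s \<longleftrightarrow> 1 \<le> ?N * s"
        by (auto simp: field_simps)
      \<comment> \<open>The two pieces overlap where \<open>?N * s = 1\<close>; there both paths are
        at the vertex \<open>g \<circ> letf l\<close>.\<close>
      then show ?thesis
        using True by (cases "?N * s = 1") (auto simp: wpath_Cons[OF True refl] diff_divide_distrib)
    next
      case False
      then have "s \<notin> {0..c} \<and> s \<notin> {c..1}" if "0 \<le> c" "c \<le> 1" for c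
        using that by auto
      from this[of "1/?N"] show ?thesis
        using False by auto
    qed
  qed
  ultimately show ?case
    by (simp only: closed_Un)
qed (simp add: Collect_conj_eq closed_Int closed_Collect_const flip: atLeastAtMost_def atLeast_def atMost_def)

lemma closed_imp_edge_closed:
  assumes "closed C"
  shows "edge_closed C"
proof -
  have "{t\<in>{0..1}. edgept w a t \<in> C} = {0..1} \<inter> edgept w a -` C" for w a
    by auto
  then show ?thesis
    using continuous_closed_preimage[OF continuous_on_edgept closed_atLeastAtMost assms]
    by (simp add: edge_closed_def)
qed

lemma continuous_on_wpath:
  assumes "g \<in> Fgrp"
  shows "continuous_on {0..1} (wpath g ws)"
proof -
  have "closed (wpath g ws -` B \<inter> {0..1})" if "closed B" for B
  proof -
    have "wpath g ws -` B \<inter> {0..1} = {s\<in>{0..1}. wpath g ws s \<in> B}"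
      by auto
    then show ?thesis
      using closed_wpath_preimage[OF closed_imp_edge_closed[OF that] assms] by simp
  qed
  then show ?thesis
    by (simp add: continuous_on_closed_vimage)
qed

section \<open>Closed sets and continuity on the 1-skeleton\<close>

lemma charC_boundary: "charC g i (s, 1) = wpath g (rel i) s"
  by (simp add: charC_def)

lemma charC_interior: "\<rho> < 1 \<Longrightarrow> charC g i (s, \<rho>) \<notin> X1car"
  by (auto simp: charC_def X1car_def edgept_def)

lemma openin_Int_Compl: "closed K \<Longrightarrow> openin (top_of_set S) (S \<inter> - K)"
  by (simp add: openin_open_Int open_Compl)

text \<open>A subset of X^1 meets a closed 2-cell only in its boundary, and the attaching map is an
  edge path, along which preimages of \<open>edge_closed\<close> sets are closed.\<close>

lemma closed_if_edge_closed:
  assumes "C \<subseteq> X1car" "edge_closed C"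
  shows "closed C"
proof -
  have "openin Xtop (- C \<inter> Xcar)"
    unfolding openin_Xtop
  proof (intro conjI ballI allI)
    fix w a assume w: "w \<in> Fgrp"
    have "{t\<in>{0..1}. edgept w a t \<in> - C \<inter> Xcar} = {0..1} \<inter> - {t\<in>{0..1}. edgept w a t \<in> C}"
      using w by auto
    then show "openin (top_of_set {0..1}) {t\<in>{0..1}. edgept w a t \<in> - C \<inter> Xcar}"
      using assms(2) w by (simp only: edge_closed_def openin_Int_Compl)
  next
    fix g and i :: nat assume g: "g \<in> Fgrp" and i: "i \<in> {0,1}"
    \<comment> \<open>The preimage of \<open>C\<close> in the square lies on the side of radius 1,
      where the characteristic map is the relator path.\<close>
    let ?K = "{s\<in>{0..1}. wpath g (rel i) s \<in> C} \<times> {1::real}"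
    have *: "charC g i (s, \<rho>) \<in> C \<longleftrightarrow> \<rho> = 1 \<and> wpath g (rel i) s \<in> C" if "\<rho> \<le> 1" for s \<rho>
    proof (cases "\<rho> = 1")
      case True
      then show ?thesis by (simp add: charC_boundary)
    next
      case False
      then have "charC g i (s, \<rho>) \<notin> C"
        using assms(1) charC_interior[of \<rho> g i s] that by (meson order_less_le subsetD)
      with False show ?thesis by simp
    qed
    have "{p\<in>{0..1} \<times> {0..1}. charC g i p \<in> - C \<inter> Xcar} = ({0..1} \<times> {0..1}) \<inter> - ?K"
    proof (rule set_eqI)
      fix p :: "real \<times> real"
      obtain s \<rho> where p: "p = (s, \<rho>)" by fastforce
      show "p \<in> {p\<in>{0..1} \<times> {0..1}. charC g i p \<in> - C \<inter> Xcar} \<longleftrightarrow> p \<in> ({0..1} \<times> {0..1}) \<inter> - ?K"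
      proof (cases "p \<in> {0..1} \<times> {0..1}")
        case True
        with charC_in_Xcar[OF g i True] show ?thesis
          using *[of \<rho> s] by (simp add: p) blast
      qed simp
    qed
    moreover have "closed ?K"
      by (intro closed_Times closed_singleton closed_wpath_preimage assms g)
    ultimately show "openin (top_of_set ({0..1} \<times> {0..1})) {p\<in>{0..1} \<times> {0..1}. charC g i p \<in> - C \<inter> Xcar}"
      by (simp only: openin_Int_Compl)
  qed auto
  then show ?thesis
    by (simp add: closed_def open_xpt_def)
qed

lemma continuous_on_X1car:
  assumes "\<And>w a. w \<in> Fgrp \<Longrightarrow> continuous_on {0..1} (\<lambda>t. f (edgept w a t))"
  shows "continuous_on X1car f"
proof -
  have "{t\<in>{0..1}. edgept w a t \<in> X1car} = {0..1}" if "w \<in> Fgrp" for w a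
    using that by auto
  then have "closed X1car"
    by (intro closed_if_edge_closed) (auto simp: edge_closed_def)
  moreover have "closed (f -` B \<inter> X1car)" if "closed B" for B
  proof (rule closed_if_edge_closed)
    show "edge_closed (f -` B \<inter> X1car)"
      unfolding edge_closed_def
    proof (intro ballI allI)
      fix w a assume w: "w \<in> Fgrp"
      have "{t\<in>{0..1}. edgept w a t \<in> f -` B \<inter> X1car} = {0..1} \<inter> (\<lambda>t. f (edgept w a t)) -` B"
        using w by auto
      then show "closed {t\<in>{0..1}. edgept w a t \<in> f -` B \<inter> X1car}"
        using continuous_closed_preimage[OF assms[OF w] closed_atLeastAtMost that] by (simp only:)
    qed
  qed auto
  ultimately show ?thesis
    by (simp add: continuous_on_closed_vimage)
qed

text \<open>Weak topologies need not be compatible with products. Here compactness of time intervals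
  helps, as in the tube lemma: the points whose track over a compact interval leaves
  \<open>B\<close> form a closed set.\<close>

lemma continuous_on_X1car_Times:
  assumes cont: "\<And>w a. w \<in> Fgrp \<Longrightarrow>
    continuous_on ({0..1} \<times> {0..1}) (\<lambda>p. f (edgept w a (fst p), snd p))"
  shows "continuous_on (X1car \<times> {0..1::real}) f"
  unfolding continuous_on_topological
proof (intro ballI allI impI)
  fix q B assume q: "q \<in> X1car \<times> {0..1::real}" and B: "open B" "f q \<in> B"
  obtain w a s0 t0 where w: "w \<in> Fgrp" "s0 \<in> {0..1}" and q_eq: "q = (edgept w a s0, t0)"
    and t0: "t0 \<in> {0..1}"
    using q by (auto elim: X1car_cases)
  have "continuous_on {0..1} ((\<lambda>p. f (edgept w a (fst p), snd p)) \<circ> (\<lambda>t. (s0, t)))"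
    by (intro continuous_on_compose continuous_on_Pair continuous_on_const continuous_on_id
        continuous_on_subset[OF cont[OF w(1)]]) (use w in auto)
  then have ct: "continuous_on {0..1} (\<lambda>t. f (edgept w a s0, t))"
    by (simp add: o_def)
  obtain T where T: "open T" "t0 \<in> T" "\<And>t. t \<in> {0..1} \<Longrightarrow> t \<in> T \<Longrightarrow> f (edgept w a s0, t) \<in> B"
    using ct[unfolded continuous_on_topological, rule_format, OF t0 B(1) B(2)[unfolded q_eq]] by metis
  obtain \<delta> where \<delta>: "\<delta> > 0" "cball t0 \<delta> \<subseteq> T"
    using T open_contains_cball by blast
  \<comment> \<open>A compact neighbourhood of \<open>t0\<close> in the unit interval over which
    \<open>f\<close> stays in \<open>B\<close> at the given edge point.\<close>
  define J where "J = cball t0 \<delta> \<inter> {0..1}"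
  have J: "compact J" "J \<subseteq> {0..1}" by (auto simp: J_def compact_Int)
  define C where "C = {x\<in>X1car. \<exists>t\<in>J. f (x, t) \<notin> B}"
  have "closed {s\<in>{0..1}. edgept u b s \<in> C}" if u: "u \<in> Fgrp" for u b
  proof -
    \<comment> \<open>Over one edge, \<open>C\<close> is the projection of this compact set to the
      edge parameter.\<close>
    let ?K = "({0..1} \<times> J) \<inter> (\<lambda>p. f (edgept u b (fst p), snd p)) -` (- B)"
    have "compact ({0..1::real} \<times> J)"
      using J by (intro compact_Times) auto
    moreover have "closed ?K"
      by (intro continuous_closed_preimage continuous_on_subset[OF cont[OF u]])
        (use J B in \<open>auto simp: closed_Times compact_imp_closed\<close>)
    ultimately have "compact ?K"
      by (metis compact_Int_closed inf.left_idem)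
    then have "compact (fst ` ?K)"
      by (intro compact_continuous_image continuous_intros)
    moreover have "fst ` ?K = {s\<in>{0..1}. edgept u b s \<in> C}"
      using u by (force simp: C_def image_iff)
    ultimately show ?thesis
      by (simp add: compact_imp_closed)
  qed
  then have "closed C"
    by (intro closed_if_edge_closed) (auto simp: C_def edge_closed_def)
  then have "open ((- C) \<times> ball t0 \<delta>)"
    by (simp add: open_Times open_Compl)
  moreover have "q \<in> (- C) \<times> ball t0 \<delta>"
    using T(3) \<delta> by (auto simp: q_eq C_def J_def)
  moreover have "f y \<in> B" if "y \<in> X1car \<times> {0..1}" "y \<in> (- C) \<times> ball t0 \<delta>" for y
    using that by (auto simp: C_def J_def)
  ultimately show "\<exists>A. open A \<and> q \<in> A \<and> (\<forall>y\<in>X1car \<times> {0..1}. y \<in> A \<longrightarrow> f y \<in> B)"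
    by blast
qed

subsection \<open>Homotopies of paths in a topological space\<close>

text \<open>The law only concerns reparametrisation. It holds for line paths in the unit interval
  and is carried by \<open>p\<close> into an arbitrary topological space.\<close>

lemma homotopic_paths_const_right:
  assumes "path p" "path_image p \<subseteq> S"
  shows "homotopic_paths S (p +++ (\<lambda>_. pathfinish p)) p"
proof -
  have "homotopic_paths {0..1} (linepath 0 1 +++ linepath 1 1) (linepath 0 (1::real))"
    using homotopic_paths_rid[of "linepath 0 (1::real)" "{0..1}"] by (simp add: closed_segment_eq_real_ivl)
  then have "homotopic_paths S (p \<circ> (linepath 0 1 +++ linepath 1 1)) (p \<circ> linepath 0 1)"
    using assms by (intro homotopic_paths_continuous_image) (auto simp: path_def path_image_def)
  moreover have "p \<circ> (linepath 0 1 +++ linepath 1 1) = p +++ (\<lambda>_. pathfinish p)" "p \<circ> linepath 0 1 = p"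
    by (auto simp: fun_eq_iff joinpaths_def linepath_def pathfinish_def)
  ultimately show ?thesis by simp
qed

lemma homotopic_paths_const_left:
  assumes "path p" "path_image p \<subseteq> S"
  shows "homotopic_paths S ((\<lambda>_. pathstart p) +++ p) p"
proof -
  have "homotopic_paths {0..1} (linepath 0 0 +++ linepath 0 1) (linepath 0 (1::real))"
    using homotopic_paths_lid[of "linepath 0 (1::real)" "{0..1}"] by (simp add: closed_segment_eq_real_ivl)
  then have "homotopic_paths S (p \<circ> (linepath 0 0 +++ linepath 0 1)) (p \<circ> linepath 0 1)"
    using assms by (intro homotopic_paths_continuous_image) (auto simp: path_def path_image_def)
  moreover have "p \<circ> (linepath 0 0 +++ linepath 0 1) = (\<lambda>_. pathstart p) +++ p" "p \<circ> linepath 0 1 = p"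
    by (auto simp: fun_eq_iff joinpaths_def linepath_def pathstart_def)
  ultimately show ?thesis by simp
qed

lemma homotopic_paths_reverse_right:
  assumes "path p" "path_image p \<subseteq> S"
  shows "homotopic_paths S (p +++ reversepath p) (\<lambda>_. pathstart p)"
proof -
  have "homotopic_paths {0..1} (linepath 0 1 +++ reversepath (linepath 0 1)) (linepath 0 (0::real))"
    using homotopic_paths_rinv[of "linepath 0 (1::real)" "{0..1}"] by (simp add: closed_segment_eq_real_ivl)
  then have "homotopic_paths S (p \<circ> (linepath 0 1 +++ reversepath (linepath 0 1))) (p \<circ> linepath 0 0)"
    using assms by (intro homotopic_paths_continuous_image) (auto simp: path_def path_image_def)
  moreover have "p \<circ> (linepath 0 1 +++ reversepath (linepath 0 1)) = p +++ reversepath p"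
    "p \<circ> linepath 0 0 = (\<lambda>_. pathstart p)"
    by (auto simp: fun_eq_iff joinpaths_def linepath_def pathstart_def reversepath_def)
  ultimately show ?thesis by simp
qed

text \<open>Append the reverse of \<open>r\<close> to both sides and contract
  \<open>r +++ reversepath r\<close>.\<close>

lemma homotopic_paths_cancel_right:
  assumes hom: "homotopic_paths S (p +++ r) (q +++ r)"
    and p: "path p" "path_image p \<subseteq> S" and q: "path q" "path_image q \<subseteq> S"
    and r: "path r" "path_image r \<subseteq> S"
    and ends: "pathfinish p = pathstart r" "pathfinish q = pathstart r"
  shows "homotopic_paths S p q"
proof -
  have *: "homotopic_paths S ((p +++ r) +++ reversepath r) p"
    if p: "path p" "path_image p \<subseteq> S" and e: "pathfinish p = pathstart r" for p
  proof -
    have "homotopic_paths S ((p +++ r) +++ reversepath r) (p +++ (r +++ reversepath r))"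
      using p r e by (intro homotopic_paths_sym[OF homotopic_paths_assoc]) auto
    also have "homotopic_paths S (p +++ (r +++ reversepath r)) (p +++ (\<lambda>_. pathfinish p))"
      using p r e homotopic_paths_reverse_right[OF r] by (intro homotopic_paths_join) auto
    also have "homotopic_paths S (p +++ (\<lambda>_. pathfinish p)) p"
      using p by (rule homotopic_paths_const_right)
    finally show ?thesis .
  qed
  have "homotopic_paths S p ((p +++ r) +++ reversepath r)"
    using *[OF p] ends by (simp add: homotopic_paths_sym)
  also have "homotopic_paths S ((p +++ r) +++ reversepath r) ((q +++ r) +++ reversepath r)"
    by (rule homotopic_paths_join) (use hom r ends in auto)
  also have "homotopic_paths S ((q +++ r) +++ reversepath r) q"
    using *[OF q] ends by simp
  finally show ?thesis .
qed

text \<open>The boundary of the unit square is contractible in the square; apply the free homotopy,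
  whose two vertical sides agree.\<close>

lemma homotopic_loops_const_imp_homotopic_paths:
  assumes "homotopic_loops S p (\<lambda>_. a)"
  shows "homotopic_paths S p (\<lambda>_. pathstart p)"
proof -
  let ?Q = "{0..1::real} \<times> {0..1::real}"
  obtain h where h: "continuous_on ?Q h" "h \<in> ?Q \<rightarrow> S"
    and h0: "\<And>x. x \<in> {0..1} \<Longrightarrow> h (0, x) = p x"
    and h1: "\<And>x. x \<in> {0..1} \<Longrightarrow> h (1, x) = a"
    and ends: "\<And>t. t \<in> {0..1} \<Longrightarrow> h (t, 1) = h (t, 0)"
    using assms by (auto simp: homotopic_loops pathfinish_def pathstart_def)
  \<comment> \<open>In \<open>h\<close> the first coordinate is homotopy time and the second the
    loop parameter. The side \<open>b\<close> carries \<open>p\<close>, \<open>m\<close> the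
    constant loop, and \<open>l\<close> and \<open>r\<close> the two tracks of the base
    point.\<close>
  define l where "l = linepath (0, 0) (1::real, 0::real)"
  define r where "r = linepath (0, 1) (1::real, 1::real)"
  define b where "b = linepath (0, 0) (0::real, 1::real)"
  define m where "m = linepath (1, 0) (1::real, 1::real)"
  have Q: "convex ?Q" "path l" "path r" "path b" "path m"
    "path_image l \<subseteq> ?Q" "path_image r \<subseteq> ?Q" "path_image b \<subseteq> ?Q" "path_image m \<subseteq> ?Q"
    unfolding l_def r_def b_def m_def
    by (simp_all only: path_linepath) (auto simp: convex_Times linepath_def path_image_def)
  have "simply_connected ?Q"
    using Q(1) by (rule convex_imp_simply_connected)
  moreover have "path (l +++ (m +++ reversepath r))" "path_image (l +++ (m +++ reversepath r)) \<subseteq> ?Q"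
    "pathstart (l +++ (m +++ reversepath r)) = pathstart b" "pathfinish (l +++ (m +++ reversepath r)) = pathfinish b"
    using Q(2-9) by (simp_all add: subset_path_image_join) (simp_all add: l_def r_def b_def m_def)
  ultimately have "homotopic_paths ?Q b (l +++ (m +++ reversepath r))"
    using Q(4,8) unfolding simply_connected_eq_homotopic_paths by blast
  then have hom: "homotopic_paths S (h \<circ> b) (h \<circ> (l +++ (m +++ reversepath r)))"
    by (rule homotopic_paths_continuous_image[OF _ h])
  moreover have "homotopic_paths S p (h \<circ> b)"
    using homotopic_loops_imp_path[OF assms] homotopic_loops_imp_subset[OF assms] h0
    by (intro homotopic_paths_eq) (auto simp: b_def linepath_def)
  moreover have "homotopic_paths S (h \<circ> (l +++ (m +++ reversepath r)))
      ((h \<circ> l) +++ ((\<lambda>_. a) +++ reversepath (h \<circ> l)))"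
  proof (rule homotopic_paths_eq)
    show "path (h \<circ> (l +++ (m +++ reversepath r)))" "path_image (h \<circ> (l +++ (m +++ reversepath r))) \<subseteq> S"
      using homotopic_paths_imp_path homotopic_paths_imp_subset hom by blast+
    show "(h \<circ> (l +++ (m +++ reversepath r))) t = ((h \<circ> l) +++ ((\<lambda>_. a) +++ reversepath (h \<circ> l))) t"
      if "t \<in> {0..1}" for t
      using that h1 ends by (auto simp: joinpaths_def reversepath_def l_def m_def r_def linepath_def)
  qed
  moreover have "homotopic_paths S ((h \<circ> l) +++ ((\<lambda>_. a) +++ reversepath (h \<circ> l))) (\<lambda>_. pathstart p)"
  proof -
    have L: "path (h \<circ> l)" "path_image (h \<circ> l) \<subseteq> S" "pathfinish (h \<circ> l) = a" "pathstart (h \<circ> l) = pathstart p"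
      using h h0 h1 Q by (auto simp: l_def path_continuous_image[OF _ continuous_on_subset[OF h(1)]]
          path_image_compose pathfinish_def pathstart_def linepath_def path_image_def)
    have "homotopic_paths S ((\<lambda>_. a) +++ reversepath (h \<circ> l)) (reversepath (h \<circ> l))"
      using homotopic_paths_const_left[of "reversepath (h \<circ> l)" S] L by simp
    then have "homotopic_paths S ((h \<circ> l) +++ ((\<lambda>_. a) +++ reversepath (h \<circ> l))) ((h \<circ> l) +++ reversepath (h \<circ> l))"
      using L by (intro homotopic_paths_join) (auto simp: pathstart_def joinpaths_def)
    also have "homotopic_paths S ((h \<circ> l) +++ reversepath (h \<circ> l)) (\<lambda>_. pathstart p)"
      using homotopic_paths_reverse_right[OF L(1,2)] L(4) by simp
    finally show ?thesis .
  qed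
  ultimately show ?thesis
    by (meson homotopic_paths_trans)
qed

text \<open>A homotopy relative to end points has \<open>p\<close> and \<open>e\<close> on one side.
  Here they are spread over two sides, so that squares of edges with a common vertex fit together
  along its combing path.\<close>

lemma homotopic_paths_square:
  assumes "homotopic_paths S (p +++ e) q"
    and "path p" "path q" "path e" "pathfinish p = pathstart e"
  obtains H where "continuous_on ({0..1} \<times> {0..1}) H" "H \<in> {0..1} \<times> {0..1} \<rightarrow> S"
    "\<And>s. s \<in> {0..1} \<Longrightarrow> H (s, 0) = pathstart p" "\<And>s. s \<in> {0..1} \<Longrightarrow> H (s, 1) = e s"
    "\<And>t. t \<in> {0..1} \<Longrightarrow> H (0, t) = p t" "\<And>t. t \<in> {0..1} \<Longrightarrow> H (1, t) = q t"
proof -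
  let ?Q = "{0..1::real} \<times> {0..1::real}"
  obtain h where h: "continuous_on ?Q h" "h \<in> ?Q \<rightarrow> S"
    and h0: "\<And>x. x \<in> {0..1} \<Longrightarrow> h (0, x) = (p +++ e) x"
    and h1: "\<And>x. x \<in> {0..1} \<Longrightarrow> h (1, x) = q x"
    and hs: "\<And>t. t \<in> {0..1} \<Longrightarrow> h (t, 0) = pathstart p"
    and hf: "\<And>t. t \<in> {0..1} \<Longrightarrow> h (t, 1) = pathfinish e"
    using assms(1) by (auto simp: homotopic_paths pathfinish_def pathstart_def joinpaths_def)
  \<comment> \<open>\<^term>\<open>\<phi>\<close> has no limit at the corner (1,1) (where 0/0 = 0), but \<^term>\<open>h\<close> collapses the
    side over 1 to a point, so \<^term>\<open>H\<close> is continuous there as well\<close>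
  define \<phi> :: "real \<times> real \<Rightarrow> real" where
    "\<phi> = (\<lambda>z. fst z * (1 - snd z) / ((1 - fst z) + fst z * (1 - snd z)))"
  define \<psi> :: "real \<times> real \<Rightarrow> real" where "\<psi> = (\<lambda>z. snd z * (1 + fst z) / 2)"
  \<comment> \<open>On the left side \<phi> is 0 and \<psi> runs from 0 to 1/2, tracing
    \<open>p\<close>; on the top \<phi> is 0 and \<psi> runs from 1/2 to 1, tracing
    \<open>e\<close>. On the right, below the corner, \<phi> is 1 and \<psi> is the height, tracing
    \<open>q\<close>.\<close>
  define H where "H = (\<lambda>z. h (\<phi> z, \<psi> z))"
  have den: "(1 - s) + s * (1 - t) > 0" if "s \<in> {0..1}" "t \<in> {0..1}" "(s, t) \<noteq> (1, 1)" for s t :: real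
  proof (cases "s = 1")
    case False
    then show ?thesis
      using that by (intro add_pos_nonneg) auto
  qed (use that in auto)
  have den': "\<forall>z\<in>?Q - {(1,1)}. (1 - fst z) + fst z * (1 - snd z) \<noteq> 0"
    using den by (force simp: less_le)
  have \<phi>: "\<phi> z \<in> {0..1}" if "z \<in> ?Q" for z
  proof (cases "z = (1, 1)")
    case False
    then show ?thesis
      using that den[of "fst z" "snd z"] by (auto simp: \<phi>_def divide_simps)
  qed (simp add: \<phi>_def)
  have \<psi>: "\<psi> z \<in> {0..1}" if "z \<in> ?Q" for z
    using that mult_mono[of "snd z" 1 "1 + fst z" 2] by (auto simp: \<psi>_def)
  have "continuous_on ?Q H"
    unfolding continuous_on_eq_continuous_within
  proof
    fix z assume z: "z \<in> ?Q"
    show "continuous (at z within ?Q) H"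
    proof (cases "z = (1, 1)")
      case False
      have "continuous_on (?Q - {(1,1)}) H"
        unfolding H_def
      proof (rule continuous_on_compose2[OF h(1)])
        show "continuous_on (?Q - {(1,1)}) (\<lambda>z. (\<phi> z, \<psi> z))"
          unfolding \<phi>_def \<psi>_def by (intro continuous_intros den') auto
      qed (use \<phi> \<psi> in auto)
      moreover have "at z within ?Q = at z within (?Q - {(1,1)})"
        using False by (intro at_within_nhd[of _ "- {(1,1)}"]) auto
      ultimately show ?thesis
        using z False by (simp add: continuous_on_eq_continuous_within)
    next
      case True
      show ?thesis
        unfolding continuous_within_topological
      proof (intro allI impI)
        fix B assume B: "open B" "H z \<in> B"
        \<comment> \<open>The heights at which \<open>h\<close> leaves \<open>B\<close> form a
          closed set that misses 1. Hence \<psi> being close to 1 suffices, whatever \<phi>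
          does.\<close>
        let ?K = "?Q \<inter> h -` (- B)"
        have "closed ?K"
          by (intro continuous_closed_preimage h closed_Times) (use B in auto)
        moreover have "compact ?Q"
          by (intro compact_Times) auto
        ultimately have "compact ?K"
          by (metis compact_Int_closed inf.left_idem)
        then have "closed (snd ` ?K)"
          by (intro compact_imp_closed compact_continuous_image continuous_intros)
        moreover have "continuous_on UNIV \<psi>"
          unfolding \<psi>_def by (intro continuous_intros) auto
        ultimately have "open (\<psi> -` (- snd ` ?K))"
          by (intro open_vimage) auto
        moreover have "z \<in> \<psi> -` (- snd ` ?K)"
          using B(2) hf[of 0] hf by (auto simp: True H_def \<psi>_def \<phi>_def)
        moreover have "H y \<in> B" if "y \<in> ?Q" "y \<in> \<psi> -` (- snd ` ?K)" for y
        proof (rule ccontr)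
          assume "H y \<notin> B"
          then have "(\<phi> y, \<psi> y) \<in> ?K"
            using \<phi>[OF that(1)] \<psi>[OF that(1)] by (simp add: H_def)
          then have "\<psi> y \<in> snd ` ?K" by force
          with that(2) show False by simp
        qed
        ultimately show "\<exists>A. open A \<and> z \<in> A \<and> (\<forall>y\<in>?Q. y \<in> A \<longrightarrow> H y \<in> B)"
          by blast
      qed
    qed
  qed
  moreover have "H \<in> ?Q \<rightarrow> S"
    using h(2) \<phi> \<psi> by (auto simp: H_def Pi_iff simp del: atLeastAtMost_iff)
  moreover have "H (s, 0) = pathstart p" if "s \<in> {0..1}" for s
    using hs[OF \<phi>[of "(s, 0)"]] that by (simp add: H_def \<psi>_def)
  moreover have "H (s, 1) = e s" if "s \<in> {0..1}" for s
    using h0[of "(1 + s) / 2"] that assms(5)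
    by (auto simp: H_def \<psi>_def \<phi>_def joinpaths_def pathfinish_def pathstart_def add_divide_distrib)
  moreover have "H (0, t) = p t" if "t \<in> {0..1}" for t
    using h0[of "t / 2"] that by (simp add: H_def \<psi>_def \<phi>_def joinpaths_def)
  moreover have "H (1, t) = q t" if "t \<in> {0..1}" for t
  proof (cases "t = 1")
    case True
    then show ?thesis
      using hf[of 0] hf[of 1] h1[of 1] by (simp add: H_def \<phi>_def \<psi>_def)
  qed (use h1 that in \<open>simp add: H_def \<phi>_def \<psi>_def\<close>)
  ultimately show ?thesis
    by (rule that)
qed

section \<open>Edge paths up to homotopy\<close>

lemma path_wpath [simp]: "g \<in> Fgrp \<Longrightarrow> path (wpath g ws)"
  by (simp add: path_def continuous_on_wpath)

lemma path_image_wpath [simp]: "g \<in> Fgrp \<Longrightarrow> path_image (wpath g ws) \<subseteq> X1car"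
  using wpath_in_X1car by (auto simp: path_image_def)

lemma path_image_wpath_Xcar [simp]: "g \<in> Fgrp \<Longrightarrow> path_image (wpath g ws) \<subseteq> Xcar"
  using path_image_wpath X1car_subset_Xcar by blast

lemma pathstart_wpath [simp]: "pathstart (wpath g ws) = Vert g"
  and pathfinish_wpath [simp]: "pathfinish (wpath g ws) = Vert (g \<circ> evalword ws)"
  by (simp_all add: pathstart_def pathfinish_def)

text \<open>The two sides are one path at different speeds: \<open>wpath\<close> gives all letters
  equal time, the join gives half of the time to the first letter.\<close>

lemma wpath_Cons_homotopic:
  assumes "g \<in> Fgrp"
  shows "homotopic_paths X1car (wpath g (l # ws)) (wpath g [l] +++ wpath (g \<circ> letf l) ws)"
proof -
  define n where "n = length ws"
  define f :: "real \<Rightarrow> real" where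
    "f = (\<lambda>t. if t \<le> 1/2 then 2 * t / (real n + 1) else (1 + (2 * t - 1) * real n) / (real n + 1))"
  have f01: "f t \<in> {0..1}" if "t \<in> {0..1}" for t
  proof -
    have "(2 * t - 1) * real n \<le> 1 * real n"
      using that by (intro mult_right_mono) auto
    then show ?thesis
      using that by (auto simp: f_def divide_simps)
  qed
  show ?thesis
  proof (rule homotopic_paths_reparametrize[where f = f])
    show "continuous_on {0..1} f"
      unfolding f_def split_01
      by (rule continuous_on_cases continuous_intros | force simp: field_simps)+
    show "f \<in> {0..1} \<rightarrow> {0..1}" using f01 by blast
    show "f 0 = 0" "f 1 = 1" by (auto simp: f_def)
    fix t :: real assume t: "t \<in> {0..1}"
    show "(wpath g [l] +++ wpath (g \<circ> letf l) ws) t = wpath g (l # ws) (f t)"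
    proof (cases "t \<le> 1/2")
      case True
      then have "(real n + 1) * f t = 2 * t"
        by (simp add: f_def)
      then show ?thesis
        using True by (simp add: wpath_Cons[OF f01[OF t] n_def] joinpaths_def)
    next
      case False
      then have *: "(real n + 1) * f t = 1 + (2 * t - 1) * real n"
        by (simp add: f_def)
      show ?thesis
      proof (cases "n = 0")
        case True
        then show ?thesis
          using False n_def * by (simp add: wpath_Cons[OF f01[OF t] n_def] joinpaths_def)
      next
        case n: False
        then have "1 < (real n + 1) * f t"
          unfolding * using False by simp
        then have "wpath g (l # ws) (f t) = wpath (g \<circ> letf l) ws (((real n + 1) * f t - 1) / real n)"
          by (simp add: wpath_Cons[OF f01[OF t] n_def])
        moreover have "((real n + 1) * f t - 1) / real n = 2 * t - 1"
          using n * by simp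
        ultimately show ?thesis
          using False by (simp add: joinpaths_def)
      qed
    qed
  qed (use assms in auto)
qed

lemma wpath_append_homotopic:
  assumes "g \<in> Fgrp"
  shows "homotopic_paths X1car (wpath g (u @ v)) (wpath g u +++ wpath (g \<circ> evalword u) v)"
  using assms
proof (induction u arbitrary: g)
  case Nil
  have "wpath g [] = (\<lambda>_. pathstart (wpath g v))"
    by (simp add: fun_eq_iff)
  then show ?case
    using homotopic_paths_const_left[of "wpath g v" X1car] Nil by (simp add: homotopic_paths_sym)
next
  case (Cons l u)
  let ?h = "g \<circ> letf l"
  have h: "?h \<in> Fgrp" using Cons.prems by (rule Fgrp_letf)
  have "homotopic_paths X1car (wpath g (l # (u @ v))) (wpath g [l] +++ wpath ?h (u @ v))"
    by (rule wpath_Cons_homotopic[OF Cons.prems])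
  also have "homotopic_paths X1car \<dots> (wpath g [l] +++ (wpath ?h u +++ wpath (?h \<circ> evalword u) v))"
    by (rule homotopic_paths_join[OF _ Cons.IH[OF h]]) (use Cons.prems in auto)
  also have "homotopic_paths X1car \<dots> ((wpath g [l] +++ wpath ?h u) +++ wpath (?h \<circ> evalword u) v)"
    by (rule homotopic_paths_assoc)
      (use Cons.prems h Fgrp_evalword[OF h, of u] in \<open>simp_all del: o_apply\<close>)
  also have "homotopic_paths X1car \<dots> (wpath g (l # u) +++ wpath (?h \<circ> evalword u) v)"
    by (rule homotopic_paths_join[OF homotopic_paths_sym[OF wpath_Cons_homotopic[OF Cons.prems]]])
      (use Fgrp_evalword[OF h, of u] in \<open>simp_all del: o_apply\<close>)
  finally show ?case
    by (simp only: comp_assoc evalword_Cons append_Cons)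
qed

lemma wpath_letter_inv:
  assumes "t \<in> {0..1}"
  shows "wpath (g \<circ> letf l) [letter_inv l] t = reversepath (wpath g [l]) t"
  using assms by (cases l rule: letf.cases) (auto simp: reversepath_def wpath_single)

text \<open>Shrinking radially to the centre of the 2-cell is a free null-homotopy of its boundary,
  which is then made relative to the base point.\<close>

lemma homotopic_wpath_rel:
  assumes "g \<in> Fgrp" "i \<in> {0,1}"
  shows "homotopic_paths Xcar (wpath g (rel i)) (\<lambda>_. Vert g)"
proof -
  have "homotopic_loops Xcar (wpath g (rel i)) (\<lambda>_. CCen g i)"
    unfolding homotopic_loops
  proof (intro exI conjI ballI)
    let ?h = "\<lambda>p. charC g i (snd p, 1 - fst p)"
    show "continuous_on ({0..1} \<times> {0..1}) ?h"
      by (rule continuous_on_compose2[OF continuous_on_charC[OF assms]])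
        (auto intro!: continuous_intros)
    show "?h \<in> {0..1} \<times> {0..1} \<rightarrow> Xcar"
      using charC_in_Xcar[OF assms] by auto
    show "?h (0, x) = wpath g (rel i) x" for x
      by (simp add: charC_boundary)
    show "?h (1, x) = CCen g i" for x
      by (simp add: charC_def)
    \<comment> \<open>On the boundary this is the triviality of the relator in F; inside the cell
      \<open>charC\<close> identifies the angles 0 and 1.\<close>
    show "pathfinish (?h \<circ> Pair t) = pathstart (?h \<circ> Pair t)" for t
      by (simp add: pathfinish_def pathstart_def charC_def evalword_rel Let_def)
  qed
  from homotopic_loops_const_imp_homotopic_paths[OF this] show ?thesis
    by simp
qed

subsection \<open>Edges over which a 0-combing extends\<close>

text \<open>These properties of the combing paths are all that the gluing argument uses. For
  \<open>Psi0\<close> the end point condition has to be derived from the hypotheses on bad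
  edges.\<close>

locale zero_combing =
  fixes P :: "elt \<Rightarrow> real \<Rightarrow> xpt"
  assumes path_P [simp]: "w \<in> Fgrp \<Longrightarrow> path (P w)"
    and path_image_P [simp]: "w \<in> Fgrp \<Longrightarrow> path_image (P w) \<subseteq> X1car"
    and pathstart_P [simp]: "w \<in> Fgrp \<Longrightarrow> pathstart (P w) = Vert eps"
    and pathfinish_P [simp]: "w \<in> Fgrp \<Longrightarrow> pathfinish (P w) = Vert w"
begin

lemma path_image_P_Xcar [simp]: "w \<in> Fgrp \<Longrightarrow> path_image (P w) \<subseteq> Xcar"
  using path_image_P X1car_subset_Xcar by blast

text \<open>Stated for words, so that the condition can be composed and cancelled along a
  relator.\<close>

definition combed :: "elt \<Rightarrow> letter list \<Rightarrow> bool" where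
  "combed h ws \<longleftrightarrow> homotopic_paths Xcar (P h +++ wpath h ws) (P (h \<circ> evalword ws))"

lemma combed_Nil: "h \<in> Fgrp \<Longrightarrow> combed h []"
proof -
  assume h: "h \<in> Fgrp"
  have "wpath h [] = (\<lambda>_. pathfinish (P h))"
    using h by (simp add: fun_eq_iff)
  then show ?thesis
    using homotopic_paths_const_right[of "P h" Xcar] h by (simp add: combed_def)
qed

lemma combing_append_homotopic:
  assumes "h \<in> Fgrp"
  shows "homotopic_paths Xcar (P h +++ wpath h (u @ v))
    ((P h +++ wpath h u) +++ wpath (h \<circ> evalword u) v)"
proof -
  have "homotopic_paths Xcar (P h +++ wpath h (u @ v)) (P h +++ (wpath h u +++ wpath (h \<circ> evalword u) v))"
    by (rule homotopic_paths_join)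
      (use assms homotopic_paths_subset[OF wpath_append_homotopic X1car_subset_Xcar] in auto)
  also have "homotopic_paths Xcar \<dots> ((P h +++ wpath h u) +++ wpath (h \<circ> evalword u) v)"
    by (rule homotopic_paths_assoc)
      (use assms Fgrp_evalword[OF assms, of u] in \<open>simp_all del: o_apply\<close>)
  finally show ?thesis .
qed

text \<open>As \<open>u\<close> is combed, the path through \<open>u\<close> may be replaced by the
  combing path of its end.\<close>

lemma combed_append:
  assumes h: "h \<in> Fgrp" and u: "combed h u"
  shows "combed h (u @ v) \<longleftrightarrow> combed (h \<circ> evalword u) v"
proof -
  have hu: "h \<circ> evalword u \<in> Fgrp" using h by (rule Fgrp_evalword)
  have "homotopic_paths Xcar ((P h +++ wpath h u) +++ wpath (h \<circ> evalword u) v)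
      (P (h \<circ> evalword u) +++ wpath (h \<circ> evalword u) v)"
    by (rule homotopic_paths_join[OF u[unfolded combed_def]]) (use h hu in auto)
  with combing_append_homotopic[OF h, of u v]
  have "homotopic_paths Xcar (P h +++ wpath h (u @ v)) (P (h \<circ> evalword u) +++ wpath (h \<circ> evalword u) v)"
    by (rule homotopic_paths_trans)
  then show ?thesis
    unfolding combed_def evalword_append comp_assoc
    by (meson homotopic_paths_trans homotopic_paths_sym)
qed

lemma combed_append_cancel:
  assumes h: "h \<in> Fgrp" and uv: "combed h (u @ v)" and v: "combed (h \<circ> evalword u) v"
  shows "combed h u"
proof -
  have hu: "h \<circ> evalword u \<in> Fgrp" using h by (rule Fgrp_evalword)
  have "homotopic_paths Xcar ((P h +++ wpath h u) +++ wpath (h \<circ> evalword u) v)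
      (P (h \<circ> evalword u) +++ wpath (h \<circ> evalword u) v)"
    using combing_append_homotopic[OF h, of u v] uv v
    unfolding combed_def evalword_append comp_assoc
    by (meson homotopic_paths_trans homotopic_paths_sym)
  then show ?thesis
    unfolding combed_def
    by (rule homotopic_paths_cancel_right)
      (use h hu in \<open>auto simp: subset_path_image_join\<close>)
qed

text \<open>The word consisting of \<open>l\<close> and its inverse is combed because its path
  contracts to a point; splitting off the combed prefix leaves the inverse letter.\<close>

lemma combed_letter_inv:
  assumes h: "h \<in> Fgrp" and l: "combed h [l]"
  shows "combed (h \<circ> letf l) [letter_inv l]"
proof -
  have hl: "h \<circ> letf l \<in> Fgrp" using h by (rule Fgrp_letf)
  have inv: "h \<circ> letf l \<circ> letf (letter_inv l) = h"
    by (cases l rule: letf.cases) (simp_all only: letf.simps letter_inv.simps genf_comp_inv not_True_eq_False not_False_eq_True)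
  have "homotopic_paths Xcar (wpath h ([l] @ [letter_inv l])) (wpath h [l] +++ wpath (h \<circ> letf l) [letter_inv l])"
    using homotopic_paths_subset[OF wpath_append_homotopic[OF h, of "[l]"] X1car_subset_Xcar] by simp
  also have "homotopic_paths Xcar \<dots> (wpath h [l] +++ reversepath (wpath h [l]))"
  proof (rule homotopic_paths_join)
    show "homotopic_paths Xcar (wpath (h \<circ> letf l) [letter_inv l]) (reversepath (wpath h [l]))"
      by (rule homotopic_paths_eq) (use hl wpath_letter_inv in auto)
  qed (use h in auto)
  also have "homotopic_paths Xcar \<dots> (wpath h [])"
    using homotopic_paths_reverse_right[of "wpath h [l]" Xcar] h
    by (simp add: wpath_Nil[abs_def])
  finally have "homotopic_paths Xcar (P h +++ wpath h ([l] @ [letter_inv l])) (P h +++ wpath h [])"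
    by (intro homotopic_paths_join) (use h in auto)
  with combed_Nil[OF h] inv have "combed h ([l] @ [letter_inv l])"
    unfolding combed_def by (auto simp: comp_assoc intro: homotopic_paths_trans)
  with combed_append[OF h l] show ?thesis
    by simp
qed

lemma combed_letters:
  assumes "h \<in> Fgrp" "\<And>j. j < length ws \<Longrightarrow> combed (h \<circ> evalword (take j ws)) [ws ! j]"
  shows "combed h ws"
  using assms
proof (induction ws arbitrary: h)
  case (Cons l ws)
  have l: "combed h [l]"
    using Cons.prems(2)[of 0] by simp
  have "combed (h \<circ> letf l) ws"
    using Cons.prems(2)[of "Suc j" for j]
    by (intro Cons.IH Fgrp_letf Cons.prems(1)) (auto simp: comp_assoc)
  then show ?case
    using combed_append[OF Cons.prems(1) l, of ws] by simp
qed (rule combed_Nil)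

lemma combed_rel:
  assumes "g \<in> Fgrp" "i \<in> {0,1}"
  shows "combed g (rel i)"
proof -
  have "homotopic_paths Xcar (P g +++ wpath g (rel i)) (P g +++ wpath g [])"
    using homotopic_wpath_rel[OF assms] assms
    by (intro homotopic_paths_join) (simp_all add: wpath_Nil[abs_def])
  with combed_Nil[OF assms(1)] show ?thesis
    unfolding combed_def evalword_rel evalword_Nil by (rule homotopic_paths_trans[rotated])
qed

text \<open>The letter x_a^-1 read at w runs along e_a(w).\<close>

definition edge_combed :: "elt \<times> gen \<Rightarrow> bool" where
  "edge_combed e \<longleftrightarrow> combed (fst e) [(snd e, False)]"

lemma combed_iff_edge_combed:
  assumes g: "g \<in> Fgrp" and k: "k < length ws"
  shows "combed (g \<circ> evalword (take k ws)) [ws ! k] \<longleftrightarrow> edge_combed (bdedge g ws k)"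
proof -
  define h where "h = g \<circ> evalword (take k ws)"
  have h: "h \<in> Fgrp" using g by (simp add: h_def)
  have Suc: "g \<circ> evalword (take (Suc k) ws) = h \<circ> letf (ws ! k)"
    using k by (simp add: take_Suc_conv_app_nth comp_assoc h_def)
  show ?thesis
  proof (cases "ws ! k" rule: letf.cases)
    case (1 a)
    have "combed h [(a, True)] \<longleftrightarrow> combed (h \<circ> genf a) [(a, False)]"
      using combed_letter_inv[OF h, of "(a, True)"]
        combed_letter_inv[OF Fgrp_genf(1)[OF h], of a "(a, False)"] by auto
    then show ?thesis
      using 1 Suc by (simp add: edge_combed_def bdedge_def flip: h_def)
  next
    case (2 a)
    then show ?thesis
      by (simp add: edge_combed_def bdedge_def flip: h_def)
  qed
qed

text \<open>Split the relator at position \<open>k\<close>. The whole word, the part before and the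
  part after \<open>k\<close> are combed, so both parts can be stripped off.\<close>

lemma edge_combed_cell:
  assumes g: "g \<in> Fgrp" and i: "i \<in> {0,1}" and k: "k < length (rel i)"
    and others: "\<And>j. j < length (rel i) \<Longrightarrow> j \<noteq> k \<Longrightarrow> edge_combed (bdedge g (rel i) j)"
  shows "edge_combed (bdedge g (rel i) k)"
proof -
  let ?r = "rel i"
  let ?h = "g \<circ> evalword (take k ?r)"
  have *: "combed (g \<circ> evalword (take j ?r)) [?r ! j]" if "j < length ?r" "j \<noteq> k" for j
    using others[OF that] combed_iff_edge_combed[OF g that(1)] by simp
  have pre: "combed g (take k ?r)"
  proof (rule combed_letters[OF g])
    fix j assume "j < length (take k ?r)"
    then show "combed (g \<circ> evalword (take j (take k ?r))) [take k ?r ! j]"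
      using *[of j] by (simp add: min_absorb1)
  qed
  have post: "combed (g \<circ> evalword (take (Suc k) ?r)) (drop (Suc k) ?r)"
  proof (rule combed_letters)
    show "g \<circ> evalword (take (Suc k) ?r) \<in> Fgrp" using g by simp
    fix j assume j: "j < length (drop (Suc k) ?r)"
    have "take (Suc k) ?r @ take j (drop (Suc k) ?r) = take (Suc k + j) ?r"
      by (simp only: take_add)
    then have "g \<circ> evalword (take (Suc k) ?r) \<circ> evalword (take j (drop (Suc k) ?r)) = g \<circ> evalword (take (Suc k + j) ?r)"
      by (metis comp_assoc evalword_append)
    then show "combed (g \<circ> evalword (take (Suc k) ?r) \<circ> evalword (take j (drop (Suc k) ?r))) [drop (Suc k) ?r ! j]"
      using *[of "Suc k + j"] j by simp
  qed
  have "combed g (take k ?r @ ([?r ! k] @ drop (Suc k) ?r))"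
    using combed_rel[OF g i] id_take_nth_drop[OF k] by simp
  then have "combed ?h ([?r ! k] @ drop (Suc k) ?r)"
    using combed_append[OF g pre] by blast
  moreover have "combed (?h \<circ> evalword [?r ! k]) (drop (Suc k) ?r)"
    using post k by (simp add: take_Suc_conv_app_nth comp_assoc)
  ultimately have "combed ?h [?r ! k]"
    using combed_append_cancel g Fgrp_evalword by blast
  then show ?thesis
    using combed_iff_edge_combed[OF g k] by simp
qed

text \<open>Based at \<open>eps\<close>, the loop and \<open>P ?v +++ reversepath (P ?v)\<close> are
  both null-homotopic; cancelling the common last path gives the triangle.\<close>

lemma edge_combed_if_contractible_loop:
  assumes w: "w \<in> Fgrp"
    and loop: "homotopic_loops X1car (P w +++ (epath w a +++ reversepath (P (w \<circ> inv (genf a))))) (\<lambda>_. x)"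
  shows "edge_combed (w, a)"
proof -
  let ?v = "w \<circ> inv (genf a)" and ?e = "wpath w [(a, False)]"
  have v: "?v \<in> Fgrp" using w by (rule Fgrp_genf)
  have e: "pathfinish ?e = Vert ?v" by simp
  note simps = w v e subset_path_image_join
  have "homotopic_paths X1car ((P w +++ ?e) +++ reversepath (P ?v)) (P w +++ (?e +++ reversepath (P ?v)))"
    by (rule homotopic_paths_sym[OF homotopic_paths_assoc]) (simp_all add: simps)
  also have "homotopic_paths X1car \<dots> (P w +++ (epath w a +++ reversepath (P ?v)))"
  proof (rule homotopic_paths_eq)
    show "(P w +++ (?e +++ reversepath (P ?v))) t = (P w +++ (epath w a +++ reversepath (P ?v))) t"
      if "t \<in> {0..1}" for t
      using that by (auto simp: joinpaths_def epath_def wpath_single)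
  qed (simp_all add: simps)
  also have "homotopic_paths X1car \<dots> (\<lambda>_. Vert eps)"
    using homotopic_loops_const_imp_homotopic_paths[OF loop] w by simp
  also have "homotopic_paths X1car \<dots> (P ?v +++ reversepath (P ?v))"
    using homotopic_paths_reverse_right[of "P ?v" X1car] v by (simp add: homotopic_paths_sym)
  finally have "homotopic_paths X1car (P w +++ ?e) (P ?v)"
    by (rule homotopic_paths_cancel_right) (simp_all add: simps)
  then show ?thesis
    using homotopic_paths_subset[OF _ X1car_subset_Xcar] by (simp add: edge_combed_def combed_def)
qed

end

subsection \<open>Null-homotopic loops are continuous\<close>

text \<open>The barycentric coordinate at \<open>v\<close>: a function on X^1 that is 1 at
  \<open>v\<close> and 0 at every other vertex.\<close>

fun vert_coord :: "elt \<Rightarrow> xpt \<Rightarrow> real" where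
  "vert_coord v (Vert u) = of_bool (u = v)"
| "vert_coord v (EPt u a t) = (1 - t) * of_bool (u = v) + t * of_bool (u \<circ> genf a = v)"
| "vert_coord v _ = 0"

lemma vert_coord_edgept:
  "t \<in> {0..1} \<Longrightarrow> vert_coord v (edgept u a t) = (1 - t) * of_bool (u = v) + t * of_bool (u \<circ> genf a = v)"
  by (auto simp: edgept_def)

lemma continuous_on_vert_coord: "continuous_on X1car (vert_coord v)"
proof (rule continuous_on_X1car)
  fix u a
  have "continuous_on {0..1} (\<lambda>t. (1 - t) * of_bool (u = v) + t * of_bool (u \<circ> genf a = v) :: real)"
    by (intro continuous_intros)
  then show "continuous_on {0..1} (\<lambda>t. vert_coord v (edgept u a t))"
    by (rule continuous_on_eq) (simp add: vert_coord_edgept)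
qed

text \<open>The vertex coordinate transfers the question to the reals, where limits are unique: the
  one-sided values at the joint must agree.\<close>

lemma path_join_ends_eq:
  assumes "path (p +++ q)" "path_image (p +++ q) \<subseteq> X1car" "path q" "path_image q \<subseteq> X1car"
    and "pathfinish p = Vert u" "pathstart q = Vert v"
  shows "u = v"
proof -
  note cont = continuous_on_subset[OF continuous_on_vert_coord[of v]]
  have "path (vert_coord v \<circ> (p +++ q))" "path (vert_coord v \<circ> q)"
    using assms by (auto intro!: path_continuous_image cont)
  then have "pathfinish (vert_coord v \<circ> p) = pathstart (vert_coord v \<circ> q)"
    by (intro path_join_path_ends) (simp_all add: path_compose_join)
  then have "vert_coord v (Vert u) = vert_coord v (Vert v)"
    using assms(5,6) by (simp add: pathfinish_def pathstart_def)
  then show ?thesis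
    by (simp split: if_splits)
qed

text \<open>Here \<open>q\<close> occupies the times from 1/2 to 3/4, so running at half speed after
  1/2 extracts \<open>p +++ q\<close>. The end points are not assumed to match, since that is what
  is to be concluded from continuity.\<close>

lemma path_join_left:
  assumes "path (p +++ (q +++ r))"
  shows "path (p +++ q)"
    and "path_image (p +++ q) \<subseteq> path_image (p +++ (q +++ r))"
proof -
  define f :: "real \<Rightarrow> real" where "f = (\<lambda>t. if t \<le> 1/2 then t else t / 2 + 1 / 4)"
  have eq: "(p +++ q) t = (p +++ (q +++ r)) (f t)" if "t \<in> {0..1}" for t
    using that by (auto simp: f_def joinpaths_def algebra_simps)
  have f: "f ` {0..1} \<subseteq> {0..1}" by (auto simp: f_def)
  have "continuous_on {0..1} f"
    unfolding f_def split_01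
    by (rule continuous_on_cases continuous_intros | force)+
  then have "continuous_on {0..1} (\<lambda>t. (p +++ (q +++ r)) (f t))"
    using continuous_on_compose2[OF assms[unfolded path_def] _ f] by blast
  then show "path (p +++ q)"
    unfolding path_def by (rule continuous_on_eq) (simp add: eq)
  show "path_image (p +++ q) \<subseteq> path_image (p +++ (q +++ r))"
    using f eq by (auto simp: path_image_def image_subset_iff)
qed

lemma path_Psi0:
  "path (Psi0 w)" "path_image (Psi0 w) \<subseteq> X1car" "pathstart (Psi0 w) = Vert eps"
  "pathfinish (Psi0 w) = Vert (evalword (eta w))"
proof -
  have "Psi0 w = wpath eps (eta w)" "eps \<circ> evalword (eta w) = evalword (eta w)"
    by (simp_all add: Psi0_def[abs_def] eps_def)
  then show "path (Psi0 w)" "path_image (Psi0 w) \<subseteq> X1car" "pathstart (Psi0 w) = Vert eps"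
    "pathfinish (Psi0 w) = Vert (evalword (eta w))"
    by simp_all
qed

lemma path_epath:
  assumes "w \<in> Fgrp"
  shows "path (epath w a)" "path_image (epath w a) \<subseteq> X1car"
    "pathstart (epath w a) = Vert w" "pathfinish (epath w a) = Vert (w \<circ> inv (genf a))"
proof -
  have eq: "wpath w [(a, False)] t = epath w a t" if "t \<in> {0..1}" for t
    using that by (simp add: epath_def wpath_single)
  show "path (epath w a)"
    using continuous_on_wpath[OF assms, of "[(a, False)]"] eq unfolding path_def
    by (rule continuous_on_eq)
  show "path_image (epath w a) \<subseteq> X1car"
    using wpath_in_X1car[OF assms, of _ "[(a, False)]"] eq by (auto simp: path_image_def)
  show "pathstart (epath w a) = Vert w" "pathfinish (epath w a) = Vert (w \<circ> inv (genf a))"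
    by (simp_all only: pathstart_def pathfinish_def epath_def) (simp_all del: o_apply)
qed

lemma good_edge_iff:
  "good_edge w a \<longleftrightarrow> homotopic_loops X1car
     (Psi0 w +++ (epath w a +++ reversepath (Psi0 (w \<circ> inv (genf a))))) (\<lambda>_. Vert eps)"
  unfolding good_edge_def homotopic_loops_def X1top_eq pjoin_def prev_def joinpaths_def
    reversepath_def pathstart_def pathfinish_def ..

lemma good_edge_ends:
  assumes w: "w \<in> Fgrp" and good: "good_edge w a"
  shows "evalword (eta w) = w" "evalword (eta (w \<circ> inv (genf a))) = w \<circ> inv (genf a)"
proof -
  let ?v = "w \<circ> inv (genf a)"
  let ?q = "epath w a +++ reversepath (Psi0 ?v)"
  have loop: "path (Psi0 w +++ ?q)" "path_image (Psi0 w +++ ?q) \<subseteq> X1car"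
    using homotopic_loops_imp_path homotopic_loops_imp_subset good[unfolded good_edge_iff] by blast+
  note e = path_epath[OF w, of a]
  show "evalword (eta w) = w"
    using path_join_ends_eq[OF path_join_left(1)[OF loop(1)] subset_trans[OF path_join_left(2)[OF loop(1)] loop(2)]]
      e path_Psi0 by blast
  \<comment> \<open>With the first joint matched, the tail is itself a path, and the same argument
    applies to its joint.\<close>
  then have fin: "pathfinish (Psi0 w) = pathstart ?q"
    using e path_Psi0 by simp
  with loop have "path ?q" "path_image ?q \<subseteq> X1car"
    by (simp_all add: path_image_join)
  then show "evalword (eta ?v) = ?v"
    using path_join_ends_eq[of "epath w a" "reversepath (Psi0 ?v)" ?v "evalword (eta ?v)"] e path_Psi0[of ?v]
    by simp
qed

subsection \<open>Endpoints of edges\<close>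

definition edge_ends :: "elt \<times> gen \<Rightarrow> elt set" where
  "edge_ends e = {fst e, fst e \<circ> inv (genf (snd e))}"

lemma edge_ends_bdedge:
  assumes "k < length ws"
  shows "edge_ends (bdedge g ws k) = {g \<circ> evalword (take k ws), g \<circ> evalword (take (Suc k) ws)}"
proof -
  define h where "h = g \<circ> evalword (take k ws)"
  have Suc: "g \<circ> evalword (take (Suc k) ws) = h \<circ> letf (ws ! k)"
    using assms by (simp add: take_Suc_conv_app_nth comp_assoc h_def)
  show ?thesis
    unfolding edge_ends_def bdedge_def Suc h_def[symmetric]
    by (cases "ws ! k" rule: letf.cases) (auto simp del: o_apply)
qed

lemma cell_edges_in_Fgrp: "g \<in> Fgrp \<Longrightarrow> e \<in> cell_edges (g, i) \<Longrightarrow> fst e \<in> Fgrp"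
  by (auto simp: cell_edges_eq bdedge_def simp del: o_apply)

text \<open>The boundary is a closed edge path, so the cyclically neighbouring position shares the
  vertex; distinct positions carry distinct edges.\<close>

lemma cell_edges_adjacent:
  assumes g: "g \<in> Fgrp" and i: "i \<in> {0,1}" and e: "e \<in> cell_edges (g, i)" and v: "v \<in> edge_ends e"
  obtains f where "f \<in> cell_edges (g, i)" "f \<noteq> e" "v \<in> edge_ends f"
proof -
  let ?n = "length (rel i)"
  have n: "?n > 1" "rel i \<noteq> []" using i by (auto simp: commw_def relA_def)
  obtain k where k: "k < ?n" "e = bdedge g (rel i) k"
    using e by (auto simp: cell_edges_eq)
  have closed: "g \<circ> evalword (take ?n (rel i)) = g \<circ> evalword (take 0 (rel i))"
    by (simp add: evalword_rel)
  have "\<exists>j<?n. j \<noteq> k \<and> v \<in> edge_ends (bdedge g (rel i) j)"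
  proof (cases "v = g \<circ> evalword (take k (rel i))")
    case True
    show ?thesis
    proof (cases k)
      case 0
      then show ?thesis
        using True closed n by (intro exI[of _ "?n - 1"]) (auto simp: edge_ends_bdedge simp del: o_apply)
    next
      case (Suc j)
      then show ?thesis
        using True k by (intro exI[of _ j]) (simp add: edge_ends_bdedge)
    qed
  next
    case False
    then have v': "v = g \<circ> evalword (take (Suc k) (rel i))"
      using v k by (simp add: edge_ends_bdedge)
    show ?thesis
    proof (cases "Suc k = ?n")
      case True
      then show ?thesis
        using v' closed n k by (intro exI[of _ 0]) (auto simp: edge_ends_bdedge simp del: o_apply)
    next
      case False
      then show ?thesis
        using v' k by (intro exI[of _ "Suc k"]) (simp add: edge_ends_bdedge)
    qed
  qed
  then obtain j where j: "j < ?n" "j \<noteq> k" "v \<in> edge_ends (bdedge g (rel i) j)"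
    by blast
  moreover have "bdedge g (rel i) j \<noteq> e"
    using inj_on_bdedge[OF i g] j k by (auto dest: inj_onD)
  ultimately show ?thesis
    using that[of "bdedge g (rel i) j"] by (auto simp: cell_edges_eq)
qed

text \<open>The number of strict predecessors decreases: those of \<open>f\<close> are among those
  of \<open>e\<close>, which also include \<open>f\<close>.\<close>

lemma wf_strict_part_if_finite_predecessors:
  assumes "trans r" "antisym r" "r \<subseteq> A \<times> A" "\<And>e. e \<in> A \<Longrightarrow> finite {f\<in>A. (f, e) \<in> r \<and> f \<noteq> e}"
  shows "wf (r - Id)"
proof (rule wf_subset[OF wf_measure[of "\<lambda>e. card {f\<in>A. (f, e) \<in> r \<and> f \<noteq> e}"]])
  show "r - Id \<subseteq> Wellfounded.measure (\<lambda>e. card {f\<in>A. (f, e) \<in> r \<and> f \<noteq> e})"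
  proof
    fix p assume "p \<in> r - Id"
    then obtain f e where p: "p = (f, e)" "(f, e) \<in> r" "f \<noteq> e" by (cases p) auto
    then have "f \<in> A" "e \<in> A" using assms(3) by auto
    moreover have "{h\<in>A. (h, f) \<in> r \<and> h \<noteq> f} \<subset> {h\<in>A. (h, e) \<in> r \<and> h \<noteq> e}"
      using p \<open>f \<in> A\<close> assms(1,2) by (auto dest: transD antisymD)
    ultimately show "p \<in> Wellfounded.measure (\<lambda>e. card {f\<in>A. (f, e) \<in> r \<and> f \<noteq> e})"
      using psubset_card_mono[OF assms(4)] by (simp add: p(1))
  qed
qed

subsection \<open>Gluing the squares\<close>

lemma (in zero_combing) combing_extension:
  assumes "\<And>e. fst e \<in> Fgrp \<Longrightarrow> edge_combed e"
  shows "\<exists>\<Psi>. is_1_combing \<Psi> \<and> (\<forall>w\<in>Fgrp. \<forall>t\<in>{0..1}. \<Psi> (Vert w, t) = P w t)"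
proof -
  let ?Q = "{0..1::real} \<times> {0..1::real}"
  \<comment> \<open>The first coordinate runs along e_a(w) from \<open>w\<close>, the second is
    combing time.\<close>
  define sq where "sq w a H \<longleftrightarrow> continuous_on ?Q H \<and> H \<in> ?Q \<rightarrow> Xcar \<and>
      (\<forall>s\<in>{0..1}. H (s, 0) = Vert eps \<and> H (s, 1) = wpath w [(a, False)] s) \<and>
      (\<forall>t\<in>{0..1}. H (0, t) = P w t \<and> H (1, t) = P (w \<circ> inv (genf a)) t)" for w a H
  have "\<exists>H. sq w a H" if w: "w \<in> Fgrp" for w a
  proof -
    have "homotopic_paths Xcar (P w +++ wpath w [(a, False)]) (P (w \<circ> inv (genf a)))"
      using assms[of "(w, a)"] w by (simp add: edge_combed_def combed_def)
    from homotopic_paths_square[OF this] w Fgrp_genf(2)[OF w, of a] show ?thesis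
      unfolding sq_def by (smt (verit) pathstart_P path_P path_wpath pathfinish_P pathstart_wpath)
  qed
  then obtain H where H: "\<And>w a. w \<in> Fgrp \<Longrightarrow> sq w a (H w a)"
    by metis
  \<comment> \<open>\<open>EPt u a s\<close> lies on the edge named after its head
    \<open>u \<circ> genf a\<close>, which the square traverses from that head; hence the parameter
    1 - s. Points of open 2-cells get a dummy value.\<close>
  define \<Psi> where "\<Psi> = (\<lambda>(x, t). case x of Vert w \<Rightarrow> P w t
    | EPt u a s \<Rightarrow> H (u \<circ> genf a) a (1 - s, t) | _ \<Rightarrow> Vert eps)"
  \<comment> \<open>At s = 0 and s = 1 the point is a vertex, and the sides of the square are the
    combing paths there, so all squares agree over vertices.\<close>
  have edge: "\<Psi> (edgept u a s, t) = H (u \<circ> genf a) a (1 - s, t)"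
    if "u \<in> Fgrp" "s \<in> {0..1}" "t \<in> {0..1}" for u a s t
  proof -
    have "P u t = H (u \<circ> genf a) a (1, t)" "P (u \<circ> genf a) t = H (u \<circ> genf a) a (0, t)"
      using H[OF Fgrp_genf(1)[OF that(1)], of a a] that(3) by (simp_all add: sq_def)
    then show ?thesis
      using that(2) by (auto simp: \<Psi>_def edgept_def)
  qed
  have "continuous_on (X1car \<times> {0..1}) \<Psi>"
  proof (rule continuous_on_X1car_Times)
    fix u a assume u: "u \<in> Fgrp"
    have "continuous_on ?Q (H (u \<circ> genf a) a)"
      using H[OF Fgrp_genf(1)[OF u]] by (simp add: sq_def)
    then have "continuous_on ?Q (\<lambda>p. H (u \<circ> genf a) a (1 - fst p, snd p))"
      by (rule continuous_on_compose2) (auto intro!: continuous_intros)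
    then show "continuous_on ?Q (\<lambda>p. \<Psi> (edgept u a (fst p), snd p))"
      by (rule continuous_on_eq) (use edge[OF u] in auto)
  qed
  moreover have "\<Psi> (x, t) \<in> Xcar" if x: "x \<in> X1car" and t: "t \<in> {0..1}" for x t
  proof -
    obtain u a s where u: "u \<in> Fgrp" "s \<in> {0..1}" "x = edgept u a s"
      using x by (rule X1car_cases)
    then show ?thesis
      using H[OF Fgrp_genf(1)[OF u(1)], of a a] t by (auto simp: edge sq_def Pi_iff)
  qed
  moreover have "\<Psi> (x, 0) = Vert eps \<and> \<Psi> (x, 1) = x" if x: "x \<in> X1car" for x
  proof -
    obtain u a s where u: "u \<in> Fgrp" "s \<in> {0..1}" "x = edgept u a s"
      using x by (rule X1car_cases)
    then show ?thesis
      using H[OF Fgrp_genf(1)[OF u(1)], of a a] by (simp add: edge sq_def wpath_single del: o_apply)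
  qed
  moreover have "\<Psi> (Vert w, t) = P w t" for w t
    by (simp add: \<Psi>_def)
  moreover have "P w t \<in> X1car" if "w \<in> Fgrp" "t \<in> {0..1}" for w t
    using path_image_P[OF that(1)] that(2) by (auto simp: path_image_def)
  ultimately show ?thesis
    by (intro exI[of _ \<Psi>]) (auto simp: is_1_combing_def X1top_eq Xtop_eq)
qed

theorem theorem4p2:
  fixes r :: "((elt \<times> gen) \<times> (elt \<times> gen)) set"
    and c :: "elt \<times> gen \<Rightarrow> elt \<times> nat"
  assumes "r \<subseteq> BadEdges \<times> BadEdges"
    and "partial_order_on BadEdges r"
    and "\<forall>e\<in>BadEdges. finite {f\<in>BadEdges. (f, e) \<in> r \<and> f \<noteq> e}"
    and "\<forall>e\<in>BadEdges. c e \<in> Cells \<and> e \<in> cell_edges (c e) \<and>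
           (\<forall>f\<in>BadEdges. f \<in> cell_edges (c e) \<and> f \<noteq> e \<longrightarrow> (f, e) \<in> r \<and> f \<noteq> e)"
  shows "\<exists>\<Psi>. is_1_combing \<Psi> \<and> (\<forall>w\<in>Fgrp. \<forall>t\<in>{0..1}. \<Psi> (Vert w, t) = Psi0 w t)"
proof -
  have wf: "wf (r - Id)"
    using assms(1-3)
    by (intro wf_strict_part_if_finite_predecessors[of r BadEdges])
      (auto simp: partial_order_on_def preorder_on_def)
  have cell: "\<exists>g i. c e = (g, i) \<and> g \<in> Fgrp \<and> i \<in> {0,1} \<and> e \<in> cell_edges (g, i)" if "e \<in> BadEdges" for e
    using assms(4) that by (cases "c e") (force simp: Cells_def)
  have bad_iff: "e \<in> BadEdges \<longleftrightarrow> \<not> good_edge (fst e) (snd e)" if "fst e \<in> Fgrp" for e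
    using that by (cases e) (simp add: BadEdges_def)
  have bad_Fgrp: "fst e \<in> Fgrp" if "e \<in> BadEdges" for e
    using that by (auto simp: BadEdges_def)
  have bad_end: "e \<in> BadEdges" if "fst e \<in> Fgrp" "v \<in> edge_ends e" "evalword (eta v) \<noteq> v" for e v
    using good_edge_ends[OF that(1), of "snd e"] that by (auto simp: bad_iff edge_ends_def)
  have bad_ends: "evalword (eta v) = v" if "e \<in> BadEdges" "v \<in> edge_ends e" for e v
    using wf that
  proof (induction e)
    case (less e)
    obtain g i where gi: "c e = (g, i)" "g \<in> Fgrp" "i \<in> {0,1}" "e \<in> cell_edges (g, i)"
      using cell[OF less.prems(1)] by blast
    obtain f where f: "f \<in> cell_edges (g, i)" "f \<noteq> e" "v \<in> edge_ends f"
      using cell_edges_adjacent[OF gi(2-4) less.prems(2)] .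
    show ?case
    \<comment> \<open>The second edge of the cell at \<open>v\<close> would be bad and smaller than
      \<open>e\<close>, against the induction hypothesis.\<close>
    proof (rule ccontr)
      assume "evalword (eta v) \<noteq> v"
      with f have "f \<in> BadEdges"
        using bad_end cell_edges_in_Fgrp[OF gi(2)] by blast
      moreover from this have "(f, e) \<in> r - Id"
        using assms(4) less.prems(1) f gi(1) by auto
      ultimately show False
        using less.IH f(3) \<open>evalword (eta v) \<noteq> v\<close> by blast
    qed
  qed
  \<comment> \<open>Any edge at \<open>w\<close> will do: if the path missed \<open>w\<close>, this
    edge would be bad, which \<open>bad_ends\<close> excludes.\<close>
  have eta: "evalword (eta w) = w" if "w \<in> Fgrp" for w
    using bad_end[of "(w, X0)" w] bad_ends[of "(w, X0)" w] that by (auto simp: edge_ends_def)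
  interpret zero_combing Psi0
    by unfold_locales (use path_Psi0 eta in simp_all)
  have good: "edge_combed e" if "fst e \<in> Fgrp" "e \<notin> BadEdges" for e
    using that edge_combed_if_contractible_loop[of "fst e" "snd e"]
    by (auto simp: bad_iff good_edge_iff)
  have bad: "edge_combed e" if "e \<in> BadEdges" for e
    using wf that
  proof (induction e)
    case (less e)
    obtain g i where gi: "c e = (g, i)" "g \<in> Fgrp" "i \<in> {0,1}" "e \<in> cell_edges (g, i)"
      using cell[OF less.prems] by blast
    then obtain k where k: "k < length (rel i)" "e = bdedge g (rel i) k"
      by (auto simp: cell_edges_eq)
    show ?case
      unfolding k(2)
    proof (rule edge_combed_cell[OF gi(2,3) k(1)])
      fix j assume j: "j < length (rel i)" "j \<noteq> k"
      let ?f = "bdedge g (rel i) j"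
      \<comment> \<open>By injectivity, the other positions carry edges different from
        \<open>e\<close>, so those that are bad precede \<open>e\<close> by the choice of
        \<open>c\<close>.\<close>
      have f: "?f \<in> cell_edges (g, i)" "?f \<noteq> e"
        using j k inj_on_bdedge[OF gi(3,2)] by (auto simp: cell_edges_eq dest: inj_onD)
      show "edge_combed ?f"
      proof (cases "?f \<in> BadEdges")
        case True
        then show ?thesis
          using less f assms(4) gi(1) by auto
      next
        case False
        then show ?thesis
          using good cell_edges_in_Fgrp[OF gi(2) f(1)] by blast
      qed
    qed
  qed
  show ?thesis
    using combing_extension good bad by blast
qed

end
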